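(* The Certain Functional Dependency problem (CFD) can be solved in polynomial time: given a schema context on a relation scheme $U$, a relation $r$ over it, and a functional dependency $X\to A$, one can decide in time polynomial in the size of the input whether $r\models_g X\to A$ holds for every reality $g$.
   Context: A relation scheme is a finite set $U=\{A_1,\dots,A_n\}$ of attributes with domains $\mathrm{dom}(A)$. A schema context assigns to each $A$ a finite lattice $L_A$ (bottom $0_A$, top $1_A$), given explicitly in the input, and a surjective comparability function $f_A:\mathrm{dom}(A)^2\to L_A$ with $f_A(u,u)=1_A$, $f_A(u,v)=f_A(v,u)$, whose values are assumed computable in constant time and of constant size. $L_U=\prod_A L_A$ (componentwise order). A relation $r$ is a finite set of tuples; $f_U(t_1,t_2)=\langle f_{A_i}(t_1[A_i],t_2[A_i])\rangle_i$, $f_U(r)=\{f_U(t_1,t_2):t_1,t_2\in r\}$. A functional dependency is $X\to A$ with $X\subseteq U$, $A\in U\setminus X$. An attribute interpretation is an increasing $h_A:L_A\to\{0,1\}$ with $h_A(0_A)=0,h_A(1_A)=1$; a schema interpretation is $g(x)=\langle h_{A_1}(x[A_1]),\dots,h_{A_n}(x[A_n])\rangle$, identified with a subset of $U$. A reality is a schema interpretation that is a $\wedge$-homomorphism into $\{0,1\}^n$ (componentwise order). $r\models_g X\to A$ means: for all $x\in f_U(r)$, $X\subseteq g(x)$ implies $A\in g(x)$. *)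

theory Defs
  imports
    "HOL-Algebra.Lattice"
    "HOL-Library.FuncSet"
    "HOL-Computational_Algebra.Polynomial"
begin

section \<open>Schema contexts, realities and functional dependencies\<close>

record ('a, 'd, 'l) schema =
  attrs :: "'a set"
  vals :: "'a \<Rightarrow> 'd set"
  lat :: "'a \<Rightarrow> 'l gorder"
  cmp :: "'a \<Rightarrow> 'd \<Rightarrow> 'd \<Rightarrow> 'l"

text \<open>
  The bottom and top of a lattice are not required to be distinct.  If they coincide for some
  attribute, then that attribute has no attribute interpretation and the schema has no reality.
\<close>

definition schema_context :: "('a, 'd, 'l) schema \<Rightarrow> bool" where
  "schema_context S \<longleftrightarrow>
     finite (attrs S) \<and>
     (\<forall>A\<in>attrs S.
        bounded_lattice (lat S A) \<and> finite (carrier (lat S A)) \<and>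
        (\<lambda>(u, v). cmp S A u v) ` (vals S A \<times> vals S A) = carrier (lat S A) \<and>
        (\<forall>u\<in>vals S A. cmp S A u u = \<top>\<^bsub>lat S A\<^esub>) \<and>
        (\<forall>u\<in>vals S A. \<forall>v\<in>vals S A. cmp S A u v = cmp S A v u))"

definition schema_lattice :: "('a, 'd, 'l) schema \<Rightarrow> ('a \<Rightarrow> 'l) gorder" where
  "schema_lattice S =
     \<lparr>carrier = (\<Pi>\<^sub>E A\<in>attrs S. carrier (lat S A)),
      eq = (=),
      le = (\<lambda>x y. \<forall>A\<in>attrs S. x A \<sqsubseteq>\<^bsub>lat S A\<^esub> y A)\<rparr>"

definition attribute_interpretation :: "'l gorder \<Rightarrow> ('l \<Rightarrow> bool) \<Rightarrow> bool" where
  "attribute_interpretation L h \<longleftrightarrow>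
     (\<forall>x\<in>carrier L. \<forall>y\<in>carrier L. x \<sqsubseteq>\<^bsub>L\<^esub> y \<longrightarrow> h x \<le> h y) \<and>
     h \<bottom>\<^bsub>L\<^esub> = False \<and> h \<top>\<^bsub>L\<^esub> = True"

text \<open>0/1-vectors indexed by the attributes are identified with sets of attributes.\<close>

definition schema_interpretation ::
  "('a, 'd, 'l) schema \<Rightarrow> (('a \<Rightarrow> 'l) \<Rightarrow> 'a set) \<Rightarrow> bool" where
  "schema_interpretation S g \<longleftrightarrow>
     (\<exists>h. (\<forall>A\<in>attrs S. attribute_interpretation (lat S A) (h A)) \<and>
          (\<forall>x\<in>carrier (schema_lattice S). g x = {A \<in> attrs S. h A (x A)}))"

definition reality :: "('a, 'd, 'l) schema \<Rightarrow> (('a \<Rightarrow> 'l) \<Rightarrow> 'a set) \<Rightarrow> bool" where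
  "reality S g \<longleftrightarrow>
     schema_interpretation S g \<and>
     (\<forall>x\<in>carrier (schema_lattice S). \<forall>y\<in>carrier (schema_lattice S).
        g (x \<sqinter>\<^bsub>schema_lattice S\<^esub> y) = g x \<inter> g y)"

definition relation_over :: "('a, 'd, 'l) schema \<Rightarrow> ('a \<Rightarrow> 'd) set \<Rightarrow> bool" where
  "relation_over S r \<longleftrightarrow> finite r \<and> r \<subseteq> (\<Pi>\<^sub>E A\<in>attrs S. vals S A)"

definition cmp_tuples :: "('a, 'd, 'l) schema \<Rightarrow> ('a \<Rightarrow> 'd) \<Rightarrow> ('a \<Rightarrow> 'd) \<Rightarrow> ('a \<Rightarrow> 'l)" where
  "cmp_tuples S t1 t2 = (\<lambda>A\<in>attrs S. cmp S A (t1 A) (t2 A))"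

definition cmp_relation :: "('a, 'd, 'l) schema \<Rightarrow> ('a \<Rightarrow> 'd) set \<Rightarrow> ('a \<Rightarrow> 'l) set" where
  "cmp_relation S r = {cmp_tuples S t1 t2 | t1 t2. t1 \<in> r \<and> t2 \<in> r}"

definition fd_over :: "('a, 'd, 'l) schema \<Rightarrow> 'a set \<Rightarrow> 'a \<Rightarrow> bool" where
  "fd_over S X A \<longleftrightarrow> X \<subseteq> attrs S \<and> A \<in> attrs S - X"

definition satisfies_fd ::
  "('a, 'd, 'l) schema \<Rightarrow> ('a \<Rightarrow> 'd) set \<Rightarrow> (('a \<Rightarrow> 'l) \<Rightarrow> 'a set) \<Rightarrow> 'a set \<Rightarrow> 'a \<Rightarrow> bool" where
  "satisfies_fd S r g X A \<longleftrightarrow> (\<forall>x\<in>cmp_relation S r. X \<subseteq> g x \<longrightarrow> A \<in> g x)"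

definition certain_fd :: "('a, 'd, 'l) schema \<Rightarrow> ('a \<Rightarrow> 'd) set \<Rightarrow> 'a set \<Rightarrow> 'a \<Rightarrow> bool" where
  "certain_fd S r X A \<longleftrightarrow> (\<forall>g. reality S g \<longrightarrow> satisfies_fd S r g X A)"


section \<open>Model of computation\<close>

text \<open>
  The machine model is Jones's WHILE language over binary trees (N. D. Jones, Computability and
  Complexity from a Programming Perspective, MIT Press 1997), extended by an oracle command.
  Unlike in the unit-cost version, every evaluated subexpression is charged the full size of its
  value, counted as a tree without sharing.  So t time units can only touch O(t) nodes, and
  programs and (oracle) Turing machines simulate each other with polynomial overhead.
\<close>

datatype data = Leaf | Pair data data

fun dsize :: "data \<Rightarrow> nat" where
  "dsize Leaf = 1"
| "dsize (Pair a b) = 1 + dsize a + dsize b"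

fun dfst :: "data \<Rightarrow> data" where
  "dfst Leaf = Leaf"
| "dfst (Pair a b) = a"

fun dsnd :: "data \<Rightarrow> data" where
  "dsnd Leaf = Leaf"
| "dsnd (Pair a b) = b"

datatype exp = EVar nat | ELeaf | EPair exp exp | EFst exp | ESnd exp

type_synonym store = "nat \<Rightarrow> data"

fun eval_exp :: "exp \<Rightarrow> store \<Rightarrow> data" where
  "eval_exp (EVar x) s = s x"
| "eval_exp ELeaf s = Leaf"
| "eval_exp (EPair a b) s = Pair (eval_exp a s) (eval_exp b s)"
| "eval_exp (EFst a) s = dfst (eval_exp a s)"
| "eval_exp (ESnd a) s = dsnd (eval_exp a s)"

fun cost_exp :: "exp \<Rightarrow> store \<Rightarrow> nat" where
  "cost_exp (EVar x) s = dsize (s x)"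
| "cost_exp ELeaf s = 1"
| "cost_exp (EPair a b) s =
     cost_exp a s + cost_exp b s + dsize (Pair (eval_exp a s) (eval_exp b s))"
| "cost_exp (EFst a) s = cost_exp a s + dsize (dfst (eval_exp a s))"
| "cost_exp (ESnd a) s = cost_exp a s + dsize (dsnd (eval_exp a s))"

datatype com =
    Assign nat exp
  | Query nat exp
  | Seq com com
  | Cond exp com com
  | Loop exp com

type_synonym oracle_fun = "data \<Rightarrow> data"

text \<open>
  \<open>exec f c s t s'\<close>: with oracle \<open>f\<close>, command \<open>c\<close> started in store \<open>s\<close> halts in store \<open>s'\<close> after
  time \<open>t\<close>.  In tests, \<^const>\<open>Leaf\<close> is false and every other tree is true.  The oracle computes its
  answer in one step; its argument and its answer are charged like any other value.
\<close>

inductive exec :: "oracle_fun \<Rightarrow> com \<Rightarrow> store \<Rightarrow> nat \<Rightarrow> store \<Rightarrow> bool" for f :: oracle_fun where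
  Assign: "exec f (Assign x e) s (1 + cost_exp e s) (s(x := eval_exp e s))"
| Query: "exec f (Query x e) s (1 + cost_exp e s + dsize (f (eval_exp e s)))
            (s(x := f (eval_exp e s)))"
| Seq: "exec f c1 s t1 s1 \<Longrightarrow> exec f c2 s1 t2 s2 \<Longrightarrow> exec f (Seq c1 c2) s (t1 + t2) s2"
| CondT: "eval_exp e s \<noteq> Leaf \<Longrightarrow> exec f c1 s t s' \<Longrightarrow>
            exec f (Cond e c1 c2) s (1 + cost_exp e s + t) s'"
| CondF: "eval_exp e s = Leaf \<Longrightarrow> exec f c2 s t s' \<Longrightarrow>
            exec f (Cond e c1 c2) s (1 + cost_exp e s + t) s'"
| LoopF: "eval_exp e s = Leaf \<Longrightarrow> exec f (Loop e c) s (1 + cost_exp e s) s"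
| LoopT: "eval_exp e s \<noteq> Leaf \<Longrightarrow> exec f c s t1 s1 \<Longrightarrow> exec f (Loop e c) s1 t2 s2 \<Longrightarrow>
            exec f (Loop e c) s (1 + cost_exp e s + t1 + t2) s2"

inductive_cases exec_AssignE: "exec f (Assign x e) s t s'"
inductive_cases exec_QueryE: "exec f (Query x e) s t s'"
inductive_cases exec_SeqE: "exec f (Seq c1 c2) s t s'"
inductive_cases exec_CondE: "exec f (Cond e c1 c2) s t s'"
inductive_cases exec_LoopE: "exec f (Loop e c) s t s'"

lemma exec_deterministic:
  "exec f c s t s' \<Longrightarrow> exec f c s t' s'' \<Longrightarrow> t' = t \<and> s'' = s'"
proof (induction arbitrary: t' s'' rule: exec.induct)
  case (Assign x e s)
  then show ?case by (rule exec_AssignE) simp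
next
  case (Query x e s)
  then show ?case by (rule exec_QueryE) simp
next
  case (Seq c1 s t1 s1 c2 t2 s2)
  from Seq.prems show ?case
  proof (rule exec_SeqE)
    fix u1 r1 u2
    assume "t' = u1 + u2" and 1: "exec f c1 s u1 r1" and 2: "exec f c2 r1 u2 s''"
    then show ?thesis using Seq.IH(1)[OF 1] Seq.IH(2)[of u2 s''] by simp
  qed
next
  case (CondT e s c1 t s' c2)
  from CondT.prems show ?case
  proof (rule exec_CondE)
    fix u assume "t' = Suc (cost_exp e s + u)" and 1: "exec f c1 s u s''"
    then show ?thesis using CondT.IH[OF 1] by simp
  qed (use CondT.hyps in simp)
next
  case (CondF e s c2 t s' c1)
  from CondF.prems show ?case
  proof (rule exec_CondE)
    fix u assume "t' = Suc (cost_exp e s + u)" and 1: "exec f c2 s u s''"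
    then show ?thesis using CondF.IH[OF 1] by simp
  qed (use CondF.hyps in simp)
next
  case (LoopF e s c)
  from LoopF.prems show ?case by (rule exec_LoopE) (use LoopF.hyps in simp_all)
next
  case (LoopT e s c t1 s1 t2 s2)
  from LoopT.prems show ?case
  proof (rule exec_LoopE)
    fix u1 r1 u2
    assume "t' = Suc (cost_exp e s + u1 + u2)"
      and 1: "exec f c s u1 r1" and 2: "exec f (Loop e c) r1 u2 s''"
    then show ?thesis using LoopT.IH(1)[OF 1] LoopT.IH(2)[of u2 s''] by simp
  qed (use LoopT.hyps in simp)
qed

text \<open>Variable 0 holds the input and the output; all other variables are initially \<^const>\<open>Leaf\<close>.\<close>

definition initial_store :: "data \<Rightarrow> store" where
  "initial_store d = (\<lambda>_. Leaf)(0 := d)"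

definition enc_bool :: "bool \<Rightarrow> data" where
  "enc_bool b = (if b then Pair Leaf Leaf else Leaf)"

definition decides_within :: "com \<Rightarrow> oracle_fun \<Rightarrow> data \<Rightarrow> nat \<Rightarrow> bool \<Rightarrow> bool" where
  "decides_within c f d n b \<longleftrightarrow>
     (\<exists>t s'. exec f c (initial_store d) t s' \<and> t \<le> n \<and> s' 0 = enc_bool b)"


section \<open>Representation of the input\<close>

text \<open>
  Attributes and lattice elements are represented by their positions in arbitrary enumerations;
  positions are written in unary, which is harmless because the input is at least as large as any
  of them.  Domain values are trees already.
\<close>

definition enumerates :: "'a list \<Rightarrow> 'a set \<Rightarrow> bool" where
  "enumerates xs M \<longleftrightarrow> distinct xs \<and> set xs = M"

fun enc_list :: "data list \<Rightarrow> data" where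
  "enc_list [] = Leaf"
| "enc_list (d # ds) = Pair d (enc_list ds)"

definition enc_nat :: "nat \<Rightarrow> data" where
  "enc_nat n = enc_list (replicate n Leaf)"

definition index_of :: "'a list \<Rightarrow> 'a \<Rightarrow> nat" where
  "index_of xs x = (THE i. i < length xs \<and> xs ! i = x)"

text \<open>
  A lattice is given by its order matrix only: row \<open>i\<close>, column \<open>j\<close> tells whether the \<open>i\<close>-th element
  is below the \<open>j\<close>-th.
\<close>

definition enc_lattice :: "'l gorder \<Rightarrow> 'l list \<Rightarrow> data" where
  "enc_lattice L xs =
     enc_list (map (\<lambda>x. enc_list (map (\<lambda>y. enc_bool (x \<sqsubseteq>\<^bsub>L\<^esub> y)) xs)) xs)"

definition enc_tuple :: "'a list \<Rightarrow> ('a \<Rightarrow> data) \<Rightarrow> data" where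
  "enc_tuple us t = enc_list (map t us)"

text \<open>
  \<open>us\<close> enumerates the attributes, \<open>ls A\<close> the lattice of attribute \<open>A\<close>, and \<open>ts\<close> the tuples of the
  relation.  The left-hand side \<open>X\<close> is given by its characteristic vector.
\<close>

definition enc_input ::
  "('a, data, 'l) schema \<Rightarrow> 'a list \<Rightarrow> ('a \<Rightarrow> 'l list) \<Rightarrow> ('a \<Rightarrow> data) list \<Rightarrow> 'a set \<Rightarrow> 'a \<Rightarrow> data"
where
  "enc_input S us ls ts X A =
     enc_list
       [enc_list (map (\<lambda>B. enc_lattice (lat S B) (ls B)) us),
        enc_list (map (enc_tuple us) ts),
        enc_list (map (\<lambda>B. enc_bool (B \<in> X)) us),
        enc_nat (index_of us A)]"

text \<open>
  The comparability functions are not part of the input; they are accessible only through the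
  oracle, whose behaviour on arguments other than those below is unconstrained.
\<close>

definition cmp_oracle ::
  "('a, data, 'l) schema \<Rightarrow> 'a list \<Rightarrow> ('a \<Rightarrow> 'l list) \<Rightarrow> oracle_fun \<Rightarrow> bool" where
  "cmp_oracle S us ls f \<longleftrightarrow>
     (\<forall>A\<in>attrs S. \<forall>u\<in>vals S A. \<forall>v\<in>vals S A.
        f (Pair (enc_nat (index_of us A)) (Pair u v)) = enc_nat (index_of (ls A) (cmp S A u v)))"

end

theory Submission
  imports Defs
begin

text \<open>
  In a finite lattice, a meet-preserving attribute interpretation is membership in the principal
  filter of some element \<open>\<noteq> \<bottom>\<close>, and the elements for different attributes can be chosen
  independently.  Hence, unless some lattice is trivial (and there is no reality), \<open>X \<rightarrow> A\<close> is violated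
  by some reality iff some pair of tuples compares to an element different from \<open>\<bottom>\<close> at every
  attribute of \<open>X\<close> and to an element different from \<open>\<top>\<close> at \<open>A\<close>: take the compared elements as
  thresholds on \<open>X\<close> and \<open>\<top>\<close> elsewhere.  This criterion is checked by looping over all pairs.
\<close>

section \<open>Characterisation of certain dependencies\<close>

text \<open>Filters serve to build counterexamples; that the criterion is sufficient comes from the
  boundary values, since every interpretation sends bottom to 0 and top to 1. Because thresholds are
  chosen attribute by attribute, a single pair of tuples decides whether some reality defeats
  \<open>X \<rightarrow> A\<close>, and no search through the possibly exponentially many realities
  arises.

  On the algorithmic side, the oracle answers with a position in an arbitrary enumeration and a
  lattice is a bare order matrix, so bottom and top must be recognised from the matrix row at that
  position. Every evaluated value is charged at full size, so the loop invariants also carry size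
  bounds: list registers hold suffixes of parts of the input, counters hold unary positions, and
  both are linear in the input size. Four nested loops (first tuple, second tuple, attribute, matrix
  entry) around linear work give a bound of degree five.\<close>

lemma schema_lattice_simps:
  "carrier (schema_lattice S) = (\<Pi>\<^sub>E A\<in>attrs S. carrier (lat S A))"
  "x \<sqsubseteq>\<^bsub>schema_lattice S\<^esub> y \<longleftrightarrow> (\<forall>A\<in>attrs S. x A \<sqsubseteq>\<^bsub>lat S A\<^esub> y A)"
  by (simp_all add: schema_lattice_def)

text \<open>The meet of the product is some greatest lower bound picked by choice, not the
  componentwise meet by definition. The componentwise \<open>m\<close> shows that one exists; the
  picked one then lies below \<open>x\<close> and \<open>y\<close> and above \<open>m\<close> at
  each attribute, which settles what is below it.\<close>

lemma le_schema_meet_iff: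
  assumes S: "schema_context S"
    and x: "x \<in> carrier (schema_lattice S)" and y: "y \<in> carrier (schema_lattice S)"
    and B: "B \<in> attrs S" and a: "a \<in> carrier (lat S B)"
  shows "a \<sqsubseteq>\<^bsub>lat S B\<^esub> (x \<sqinter>\<^bsub>schema_lattice S\<^esub> y) B
           \<longleftrightarrow> a \<sqsubseteq>\<^bsub>lat S B\<^esub> x B \<and> a \<sqsubseteq>\<^bsub>lat S B\<^esub> y B"
proof -
  let ?P = "schema_lattice S"
  have L: "bounded_lattice (lat S C)" if "C \<in> attrs S" for C
    using S that by (simp add: schema_context_def)
  have xy: "x C \<in> carrier (lat S C)" "y C \<in> carrier (lat S C)" if "C \<in> attrs S" for C
    using x y that by (auto simp: schema_lattice_simps)
  define m where "m = (\<lambda>C\<in>attrs S. x C \<sqinter>\<^bsub>lat S C\<^esub> y C)"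
  have m: "m C \<in> carrier (lat S C)" "m C \<sqsubseteq>\<^bsub>lat S C\<^esub> x C" "m C \<sqsubseteq>\<^bsub>lat S C\<^esub> y C"
    "\<And>z. z \<in> carrier (lat S C) \<Longrightarrow> z \<sqsubseteq>\<^bsub>lat S C\<^esub> x C \<Longrightarrow> z \<sqsubseteq>\<^bsub>lat S C\<^esub> y C \<Longrightarrow> z \<sqsubseteq>\<^bsub>lat S C\<^esub> m C"
    if C: "C \<in> attrs S" for C
  proof -
    interpret bounded_lattice "lat S C" by (rule L[OF C])
    show "m C \<in> carrier (lat S C)" "m C \<sqsubseteq>\<^bsub>lat S C\<^esub> x C" "m C \<sqsubseteq>\<^bsub>lat S C\<^esub> y C"
      using xy[OF C] C by (simp_all add: m_def meet_left meet_right)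
    show "z \<sqsubseteq>\<^bsub>lat S C\<^esub> m C"
      if "z \<in> carrier (lat S C)" "z \<sqsubseteq>\<^bsub>lat S C\<^esub> x C" "z \<sqsubseteq>\<^bsub>lat S C\<^esub> y C" for z
      using meet_le[of z "x C" "y C"] that xy[OF C] C by (simp add: m_def)
  qed
  have "greatest ?P m (Lower ?P {x, y})"
    using x y m by (auto simp: greatest_def Lower_def schema_lattice_simps m_def PiE_iff)
  then have "greatest ?P (x \<sqinter>\<^bsub>?P\<^esub> y) (Lower ?P {x, y})"
    unfolding meet_def inf_def by (rule someI[where P = "\<lambda>z. greatest _ z _"])
  moreover have "m \<in> Lower ?P {x, y}"
    using x y m by (auto simp: Lower_def schema_lattice_simps m_def PiE_iff)
  ultimately have w: "(x \<sqinter>\<^bsub>?P\<^esub> y) B \<in> carrier (lat S B)"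
    "(x \<sqinter>\<^bsub>?P\<^esub> y) B \<sqsubseteq>\<^bsub>lat S B\<^esub> x B" "(x \<sqinter>\<^bsub>?P\<^esub> y) B \<sqsubseteq>\<^bsub>lat S B\<^esub> y B"
    "m B \<sqsubseteq>\<^bsub>lat S B\<^esub> (x \<sqinter>\<^bsub>?P\<^esub> y) B"
    using x y B by (auto simp: greatest_def Lower_def schema_lattice_simps)
  interpret bounded_lattice "lat S B" by (rule L[OF B])
  show ?thesis
    using w m[OF B] xy[OF B] a by (meson le_trans)
qed

text \<open>Lying above \<open>a B\<close> commutes with meets by the universal property of the
  meet; \<open>a B\<close> being different from bottom is what sends bottom to 0.\<close>

lemma reality_of_thresholds:
  assumes S: "schema_context S"
    and a: "\<And>B. B \<in> attrs S \<Longrightarrow> a B \<in> carrier (lat S B) \<and> a B \<noteq> \<bottom>\<^bsub>lat S B\<^esub>"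
  shows "reality S (\<lambda>x. {B \<in> attrs S. a B \<sqsubseteq>\<^bsub>lat S B\<^esub> x B})"
proof -
  have "attribute_interpretation (lat S B) (\<lambda>y. a B \<sqsubseteq>\<^bsub>lat S B\<^esub> y)" if B: "B \<in> attrs S" for B
  proof -
    interpret bounded_lattice "lat S B" using S B by (simp add: schema_context_def)
    show ?thesis
      using a[OF B] by (auto simp: attribute_interpretation_def intro: le_trans le_antisym)
  qed
  then have "schema_interpretation S (\<lambda>x. {B \<in> attrs S. a B \<sqsubseteq>\<^bsub>lat S B\<^esub> x B})"
    unfolding schema_interpretation_def
    by (intro exI[of _ "\<lambda>B y. a B \<sqsubseteq>\<^bsub>lat S B\<^esub> y"]) auto
  then show ?thesis
    using le_schema_meet_iff[OF S] a by (auto simp: reality_def)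
qed

lemma cmp_in_carrier:
  assumes "schema_context S" "B \<in> attrs S" "u \<in> vals S B" "v \<in> vals S B"
  shows "cmp S B u v \<in> carrier (lat S B)"
  using assms unfolding schema_context_def by blast

lemma relation_over_vals:
  assumes "relation_over S r" "t \<in> r" "B \<in> attrs S"
  shows "t B \<in> vals S B"
  using assms unfolding relation_over_def by (blast dest: PiE_mem)

lemma certain_fd_iff:
  assumes S: "schema_context S" and r: "relation_over S r" and fd: "fd_over S X A"
  shows "certain_fd S r X A \<longleftrightarrow>
    (\<exists>B\<in>attrs S. \<bottom>\<^bsub>lat S B\<^esub> = \<top>\<^bsub>lat S B\<^esub>) \<or>
    (\<forall>t1\<in>r. \<forall>t2\<in>r. (\<exists>B\<in>X. cmp S B (t1 B) (t2 B) = \<bottom>\<^bsub>lat S B\<^esub>) \<or>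
       cmp S A (t1 A) (t2 A) = \<top>\<^bsub>lat S A\<^esub>)" (is "_ \<longleftrightarrow> ?triv \<or> ?R")
proof
  assume certain: "certain_fd S r X A"
  show "?triv \<or> ?R"
  proof (rule ccontr)
    assume "\<not> (?triv \<or> ?R)"
    then obtain t1 t2 where nontriv: "\<And>B. B \<in> attrs S \<Longrightarrow> \<bottom>\<^bsub>lat S B\<^esub> \<noteq> \<top>\<^bsub>lat S B\<^esub>"
      and t: "t1 \<in> r" "t2 \<in> r"
      and X: "\<And>B. B \<in> X \<Longrightarrow> cmp S B (t1 B) (t2 B) \<noteq> \<bottom>\<^bsub>lat S B\<^esub>"
      and A: "cmp S A (t1 A) (t2 A) \<noteq> \<top>\<^bsub>lat S A\<^esub>"
      by blast
    define x where "x = cmp_tuples S t1 t2"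
    define a where "a B = (if B \<in> X then x B else \<top>\<^bsub>lat S B\<^esub>)" for B
    define g where "g = (\<lambda>x. {B \<in> attrs S. a B \<sqsubseteq>\<^bsub>lat S B\<^esub> x B})"
    have XA: "X \<subseteq> attrs S" "A \<in> attrs S" "A \<notin> X"
      using fd by (auto simp: fd_over_def)
    have x_B: "x B = cmp S B (t1 B) (t2 B)" "x B \<in> carrier (lat S B)" if "B \<in> attrs S" for B
      using that cmp_in_carrier[OF S that] relation_over_vals[OF r _ that] t
      by (simp_all add: x_def cmp_tuples_def)
    have L: "bounded_lattice (lat S B)" if "B \<in> attrs S" for B
      using S that by (simp add: schema_context_def)
    \<comment> \<open>Off \<open>X\<close> the threshold is top, which differs from bottom because
      no lattice is trivial here.\<close>
    have "a B \<in> carrier (lat S B) \<and> a B \<noteq> \<bottom>\<^bsub>lat S B\<^esub>" if B: "B \<in> attrs S" for B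
    proof -
      interpret bounded_lattice "lat S B" by (rule L[OF B])
      show ?thesis
        using B x_B[OF B] X nontriv[OF B, symmetric] by (auto simp: a_def)
    qed
    then have "reality S g"
      unfolding g_def by (rule reality_of_thresholds[OF S])
    with certain have "satisfies_fd S r g X A"
      by (simp add: certain_fd_def)
    moreover have "x \<in> cmp_relation S r"
      using t by (auto simp: cmp_relation_def x_def)
    moreover have "X \<subseteq> g x"
    proof
      fix B assume "B \<in> X"
      with XA have B: "B \<in> attrs S" by auto
      interpret bounded_lattice "lat S B" by (rule L[OF B])
      show "B \<in> g x"
        using B \<open>B \<in> X\<close> x_B[OF B] by (simp add: g_def a_def)
    qed
    ultimately have "A \<in> g x" by (simp add: satisfies_fd_def)
    interpret bounded_lattice "lat S A" by (rule L[OF XA(2)])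
    \<comment> \<open>Since \<open>A \<notin> X\<close>, the threshold at \<open>A\<close> is top,
      and only top lies above it.\<close>
    have "x A = \<top>\<^bsub>lat S A\<^esub>"
      using \<open>A \<in> g x\<close> XA x_B[OF XA(2)] by (auto simp: g_def a_def intro: le_antisym)
    with A x_B XA show False by simp
  qed
next
  \<comment> \<open>Bottom and top have prescribed images under every interpretation, so the
    conclusion holds for each reality separately.\<close>
  assume R: "?triv \<or> ?R"
  show "certain_fd S r X A"
    unfolding certain_fd_def satisfies_fd_def
  proof (intro allI impI ballI)
    fix g x assume "reality S g" and "x \<in> cmp_relation S r" and Xg: "X \<subseteq> g x"
    then obtain h t1 t2
      where h: "\<And>B. B \<in> attrs S \<Longrightarrow> attribute_interpretation (lat S B) (h B)"
      and g: "\<And>x. x \<in> carrier (schema_lattice S) \<Longrightarrow> g x = {B \<in> attrs S. h B (x B)}"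
      and t: "t1 \<in> r" "t2 \<in> r" and x: "x = cmp_tuples S t1 t2"
      unfolding reality_def schema_interpretation_def cmp_relation_def by blast
    have h01: "\<not> h B \<bottom>\<^bsub>lat S B\<^esub>" "h B \<top>\<^bsub>lat S B\<^esub>" if "B \<in> attrs S" for B
      using h[OF that] by (auto simp: attribute_interpretation_def)
    have "x \<in> carrier (schema_lattice S)"
      using t cmp_in_carrier[OF S] relation_over_vals[OF r]
      by (auto simp: x cmp_tuples_def schema_lattice_simps)
    then have gx: "g x = {B \<in> attrs S. h B (cmp S B (t1 B) (t2 B))}"
      using g by (auto simp: x cmp_tuples_def)
    have "\<not> ?triv" using h01 by metis
    with R t have "(\<exists>B\<in>X. cmp S B (t1 B) (t2 B) = \<bottom>\<^bsub>lat S B\<^esub>) \<or>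
        cmp S A (t1 A) (t2 A) = \<top>\<^bsub>lat S A\<^esub>" by blast
    then show "A \<in> g x"
    proof
      assume "\<exists>B\<in>X. cmp S B (t1 B) (t2 B) = \<bottom>\<^bsub>lat S B\<^esub>"
      with Xg gx h01 show ?thesis by force
    next
      assume "cmp S A (t1 A) (t2 A) = \<top>\<^bsub>lat S A\<^esub>"
      with fd h01 show ?thesis by (simp add: gx fd_over_def)
    qed
  qed
qed

section \<open>Reasoning about running times\<close>

text \<open>Total correctness with a time budget. As \<open>exec\<close> is deterministic, the run
  asserted to exist is the only one.\<close>

definition runs :: "oracle_fun \<Rightarrow> com \<Rightarrow> store \<Rightarrow> nat \<Rightarrow> (store \<Rightarrow> bool) \<Rightarrow> bool" where
  "runs f c s n Q \<longleftrightarrow> (\<exists>t s'. exec f c s t s' \<and> t \<le> n \<and> Q s')"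

lemma runs_mono:
  "runs f c s m P \<Longrightarrow> m \<le> n \<Longrightarrow> (\<And>s'. P s' \<Longrightarrow> Q s') \<Longrightarrow> runs f c s n Q"
  unfolding runs_def by (meson le_trans)

lemma runs_Assign [simp]:
  "runs f (Assign x e) s n Q \<longleftrightarrow> 1 + cost_exp e s \<le> n \<and> Q (s(x := eval_exp e s))"
  unfolding runs_def by (rule iffI; fastforce elim!: exec_AssignE intro: exec.Assign)

lemma runs_SeqI:
  "runs f c1 s m (\<lambda>s'. runs f c2 s' k Q) \<Longrightarrow> m + k \<le> n \<Longrightarrow> runs f (Seq c1 c2) s n Q"
  unfolding runs_def using add_le_mono by (blast intro: exec.Seq order_trans)

text \<open>Such equivalences let the simplifier execute straight-line code symbolically, deducting
  each cost from the budget; the conjunct \<open>\<le> n\<close> guards the truncated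
  subtraction.\<close>

lemma runs_Seq_Assign [simp]:
  "runs f (Seq (Assign x e) c) s n Q \<longleftrightarrow>
     1 + cost_exp e s \<le> n \<and> runs f c (s(x := eval_exp e s)) (n - (1 + cost_exp e s)) Q"
  unfolding runs_def
  by (rule iffI; fastforce elim!: exec_SeqE exec_AssignE intro: exec.Seq exec.Assign)

lemma runs_Seq_Query [simp]:
  "runs f (Seq (Query x e) c) s n Q \<longleftrightarrow>
     1 + cost_exp e s + dsize (f (eval_exp e s)) \<le> n \<and>
     runs f c (s(x := f (eval_exp e s))) (n - (1 + cost_exp e s + dsize (f (eval_exp e s)))) Q"
  unfolding runs_def
  by (rule iffI; fastforce elim!: exec_SeqE exec_QueryE intro: exec.Seq exec.Query)

lemma runs_Cond [simp]:
  "runs f (Cond e c1 c2) s n Q \<longleftrightarrow>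
     1 + cost_exp e s \<le> n \<and>
     (if eval_exp e s = Leaf then runs f c2 s (n - (1 + cost_exp e s)) Q
      else runs f c1 s (n - (1 + cost_exp e s)) Q)"
  unfolding runs_def
  by (rule iffI; fastforce elim!: exec_CondE intro: exec.CondT exec.CondF split: if_splits)

text \<open>The continuation is copied into both branches, so no assertion has to be found for the
  point where they join.\<close>

lemma runs_Seq_Cond [simp]:
  "runs f (Seq (Cond e c1 c2) c) s n Q \<longleftrightarrow>
     1 + cost_exp e s \<le> n \<and>
     (if eval_exp e s = Leaf then runs f (Seq c2 c) s (n - (1 + cost_exp e s)) Q
      else runs f (Seq c1 c) s (n - (1 + cost_exp e s)) Q)"
  unfolding runs_def
  by (rule iffI;
      fastforce elim!: exec_SeqE exec_CondE intro: exec.Seq exec.CondT exec.CondF split: if_splits)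

lemma runs_Seq_assoc [simp]:
  "runs f (Seq (Seq c1 c2) c) s n Q \<longleftrightarrow> runs f (Seq c1 (Seq c2 c)) s n Q"
  unfolding runs_def by (fastforce elim!: exec_SeqE intro: exec.Seq simp: add.assoc)

text \<open>A pass pays \<open>n\<close> for the body, \<open>M\<close> for reading the tested
  register and 1 for the test. The final 2 is the failing test, where the register holds a
  \<open>Leaf\<close> of size 1.\<close>

lemma runs_Loop_nat:
  assumes "I k s"
    and "\<And>k s. I (Suc k) s \<Longrightarrow> s x \<noteq> Leaf \<and> dsize (s x) \<le> M \<and> runs f c s n (I k)"
    and "\<And>s. I 0 s \<Longrightarrow> s x = Leaf"
  shows "runs f (Loop (EVar x) c) s (k * (n + M + 1) + 2) (I 0)"
  using assms(1)
proof (induction k arbitrary: s)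
  case 0
  then show ?case
    using exec.LoopF[of "EVar x" s f c] assms(3)[OF 0] unfolding runs_def by fastforce
next
  case (Suc k)
  from assms(2)[OF Suc.prems] obtain t1 s1
    where 1: "s x \<noteq> Leaf" "dsize (s x) \<le> M" "exec f c s t1 s1" "t1 \<le> n" "I k s1"
    by (auto simp: runs_def)
  from Suc.IH[OF 1(5)] obtain t2 s2
    where 2: "exec f (Loop (EVar x) c) s1 t2 s2" "t2 \<le> k * (n + M + 1) + 2" "I 0 s2"
    by (auto simp: runs_def)
  have "exec f (Loop (EVar x) c) s (1 + cost_exp (EVar x) s + t1 + t2) s2"
    using 1 2 by (intro exec.LoopT) auto
  then show ?case
    using 1 2 unfolding runs_def by (intro exI conjI) auto
qed

text \<open>The invariant is indexed by the items still to be processed, and their number is the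
  variant. Using one \<open>M\<close> for length and size keeps the bound dependent on the input
  size only.\<close>

lemma runs_Loop_list:
  assumes "I ds s" and "length ds \<le> M"
    and "\<And>d ds s. I (d # ds) s \<Longrightarrow> s x \<noteq> Leaf \<and> dsize (s x) \<le> M \<and> runs f c s n (I ds)"
    and "\<And>s. I [] s \<Longrightarrow> s x = Leaf"
  shows "runs f (Loop (EVar x) c) s (M * (n + M + 1) + 2) (I [])"
proof -
  have "runs f (Loop (EVar x) c) s (length ds * (n + M + 1) + 2)
          (\<lambda>s'. \<exists>ds'. length ds' = 0 \<and> I ds' s')"
  proof (rule runs_Loop_nat)
    fix k s assume "\<exists>ds'. length ds' = Suc k \<and> I ds' s"
    then obtain d ds' where "length ds' = k" "I (d # ds') s"
      by (auto simp: length_Suc_conv)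
    with assms(3)[of d ds' s]
    show "s x \<noteq> Leaf \<and> dsize (s x) \<le> M \<and> runs f c s n (\<lambda>s'. \<exists>ds'. length ds' = k \<and> I ds' s')"
      by (auto elim!: runs_mono)
  qed (use assms in auto)
  then show ?thesis
    by (rule runs_mono) (use assms(2) in \<open>simp_all add: add_mono mult_le_mono1 del: mult_Suc_right\<close>)
qed

section \<open>Sizes of encodings\<close>

lemma dsize_pos [simp]: "0 < dsize d" by (cases d) auto

lemma dsize_dsnd_le: "dsize (dsnd d) \<le> dsize d"
  by (cases d) simp_all

lemma dsize_enc_bool_le: "dsize (enc_bool b) \<le> 3" by (simp add: enc_bool_def)

lemma enc_bool_eq_Leaf_iff [simp]: "enc_bool b = Leaf \<longleftrightarrow> \<not> b" by (simp add: enc_bool_def)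

lemma enc_list_eq_Leaf_iff [simp]: "enc_list ds = Leaf \<longleftrightarrow> ds = []" by (cases ds) auto

lemma dsnd_enc_list [simp]: "dsnd (enc_list ds) = enc_list (tl ds)" by (cases ds) auto

text \<open>Each entry adds a pair node and at least one node of its own. The form matches the size
  of \<open>enc_nat\<close>, so a unary position in a list is never larger than the encoded
  list.\<close>

lemma dsize_enc_list_ge: "2 * length ds + 1 \<le> dsize (enc_list ds)"
proof (induction ds)
  case (Cons d ds)
  then show ?case using dsize_pos[of d] by (simp del: dsize_pos)
qed simp

lemma dsize_enc_list_mem: "d \<in> set ds \<Longrightarrow> dsize d \<le> dsize (enc_list ds)"
  by (induction ds) auto

lemma dsize_enc_list_append: "dsize (enc_list ds) \<le> dsize (enc_list (cs @ ds))"
  by (induction cs) auto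

lemma dsize_enc_list_map_suffix:
  "dsize (enc_list (map h ys)) \<le> dsize (enc_list (map h (xs @ ys)))"
  using dsize_enc_list_append[of "map h ys" "map h xs"] by simp

lemma enc_nat_0 [simp]: "enc_nat 0 = Leaf"
  and enc_nat_Suc [simp]: "enc_nat (Suc n) = Pair Leaf (enc_nat n)"
  by (simp_all add: enc_nat_def)

lemma dsize_enc_nat [simp]: "dsize (enc_nat n) = 2 * n + 1"
  by (induction n) simp_all

lemma index_of_nth:
  assumes "distinct xs" "i < length xs"
  shows "index_of xs (xs ! i) = i"
  unfolding index_of_def
  by (rule the_equality) (use assms nth_eq_iff_index_eq in auto)

section \<open>Comparing two values\<close>

abbreviation Seq_infix :: "com \<Rightarrow> com \<Rightarrow> com" (infixr ";;" 60) where
  "c1 ;; c2 \<equiv> Seq c1 c2"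

abbreviation ETrue :: exp where "ETrue \<equiv> EPair ELeaf ELeaf"

abbreviation skip_com :: com where "skip_com \<equiv> Assign 16 ELeaf"

text \<open>
  Register use.  0: verdict so far; 2--5: the four components of the input; 6: some lattice is
  trivial; 7, 8: remaining first and second tuples; 10--13: remaining lattices, remaining
  characteristic vector of the left-hand side, remaining values of the two current tuples; 14: unary
  attribute position; 15: some attribute of the left-hand side compares to bottom; 20--23: the
  attribute, the two values and the lattice of a comparison; 24, 25: its results \<open>\<noteq> \<bottom>\<close> and
  \<open>\<noteq> \<top>\<close>; 16, 26, 27: scratch.  Apart from the verdict, a subprogram only writes registers above
  those its callers rely on, so frame conditions are bounds on register numbers.

  The comparison scans the order-matrix row of the queried element \<open>a\<close>: \<open>a\<close> is bottom iff the row
  contains no false entry, and top iff it contains a single true entry.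
\<close>

definition seek_row_com :: com where
  "seek_row_com = Assign 23 (ESnd (EVar 23)) ;; Assign 26 (ESnd (EVar 26))"

text \<open>Registers 27 and 25 are a counter of true entries saturating at two: 25 inherits the old
  value of 27 before 27 is set.\<close>

definition scan_row_com :: com where
  "scan_row_com =
     Cond (EFst (EVar 23))
       (Assign 25 (EVar 27) ;; Assign 27 ETrue)
       (Assign 24 ETrue) ;;
     Assign 23 (ESnd (EVar 23))"

definition compare_com :: com where
  "compare_com =
     Query 26 (EPair (EVar 20) (EPair (EVar 21) (EVar 22))) ;;
     Loop (EVar 26) seek_row_com ;;
     Assign 23 (EFst (EVar 23)) ;;
     Assign 24 ELeaf ;;
     Assign 25 ELeaf ;;
     Assign 27 ELeaf ;;
     Loop (EVar 23) scan_row_com"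

text \<open>The numeric constants in the time bounds are generous.\<close>

definition loop_time :: "nat \<Rightarrow> nat \<Rightarrow> nat" where
  "loop_time N n = N * (n + N + 1) + 2"

definition compare_time :: "nat \<Rightarrow> nat" where
  "compare_time N = 2 * loop_time N (20 * N + 20) + 20 * N + 20"

text \<open>The up-set of \<open>a\<close> contains \<open>a\<close> and top, which coincide only if
  \<open>a\<close> is top; then nothing else lies above. Distinctness of \<open>xs\<close> equates
  counted entries with elements.\<close>

lemma two_le_count_above_iff:
  assumes "bounded_lattice L" "enumerates xs (carrier L)" "a \<in> carrier L"
  shows "2 \<le> length (filter id (map (\<lambda>y. a \<sqsubseteq>\<^bsub>L\<^esub> y) xs)) \<longleftrightarrow> a \<noteq> \<top>\<^bsub>L\<^esub>"
proof -
  interpret bounded_lattice L by fact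
  have xs: "distinct xs" "set xs = carrier L"
    using assms by (auto simp: enumerates_def)
  have "length (filter id (map (\<lambda>y. a \<sqsubseteq>\<^bsub>L\<^esub> y) xs)) = card {y \<in> carrier L. a \<sqsubseteq>\<^bsub>L\<^esub> y}"
    using xs by (simp add: filter_map comp_def distinct_length_filter Int_def conj_commute)
  also have "2 \<le> card {y \<in> carrier L. a \<sqsubseteq>\<^bsub>L\<^esub> y} \<longleftrightarrow> a \<noteq> \<top>\<^bsub>L\<^esub>"
  proof
    assume "2 \<le> card {y \<in> carrier L. a \<sqsubseteq>\<^bsub>L\<^esub> y}"
    moreover have "{y \<in> carrier L. \<top>\<^bsub>L\<^esub> \<sqsubseteq>\<^bsub>L\<^esub> y} = {\<top>\<^bsub>L\<^esub>}"
      by (auto intro: le_antisym)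
    ultimately show "a \<noteq> \<top>\<^bsub>L\<^esub>" by auto
  next
    assume "a \<noteq> \<top>\<^bsub>L\<^esub>"
    then have "card {a, \<top>\<^bsub>L\<^esub>} = 2" by simp
    moreover have "{a, \<top>\<^bsub>L\<^esub>} \<subseteq> {y \<in> carrier L. a \<sqsubseteq>\<^bsub>L\<^esub> y}" using assms by auto
    moreover have "finite {y \<in> carrier L. a \<sqsubseteq>\<^bsub>L\<^esub> y}"
      using xs(2) by (metis finite_set finite_Collect_conjI Collect_mem_eq)
    ultimately show "2 \<le> card {y \<in> carrier L. a \<sqsubseteq>\<^bsub>L\<^esub> y}"
      using card_mono by metis
  qed
  finally show ?thesis .
qed

lemma not_le_all_iff:
  assumes "bounded_lattice L" "enumerates xs (carrier L)" "a \<in> carrier L"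
  shows "False \<in> set (map (\<lambda>y. a \<sqsubseteq>\<^bsub>L\<^esub> y) xs) \<longleftrightarrow> a \<noteq> \<bottom>\<^bsub>L\<^esub>"
proof -
  interpret bounded_lattice L by fact
  show ?thesis
    using assms(2,3) bottom_eq[OF assms(3)] by (auto simp: enumerates_def image_iff)
qed

lemma runs_compare:
  assumes L: "bounded_lattice L" and xs: "enumerates xs (carrier L)" and a: "a \<in> carrier L"
    and f: "f (Pair (s 20) (Pair (s 21) (s 22))) = enc_nat (index_of xs a)"
    and m: "s 23 = enc_lattice L xs"
    and size: "dsize (s 20) \<le> N" "dsize (s 21) \<le> N" "dsize (s 22) \<le> N" "dsize (s 23) \<le> N"
  shows "runs f compare_com s (compare_time N)
    (\<lambda>s'. s' 24 = enc_bool (a \<noteq> \<bottom>\<^bsub>L\<^esub>) \<and> s' 25 = enc_bool (a \<noteq> \<top>\<^bsub>L\<^esub>) \<and> (\<forall>v<20. s' v = s v))"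
proof -
  define rows where "rows = map (\<lambda>x. enc_list (map (\<lambda>y. enc_bool (x \<sqsubseteq>\<^bsub>L\<^esub> y)) xs)) xs"
  define row where "row = map (\<lambda>y. a \<sqsubseteq>\<^bsub>L\<^esub> y) xs"
  define j where "j = index_of xs a"
  obtain i where i: "i < length xs" "xs ! i = a"
    using xs a by (metis enumerates_def in_set_conv_nth)
  then have j: "j < length xs" "xs ! j = a"
    using xs index_of_nth[of xs i] by (auto simp: j_def enumerates_def)
  have rows: "s 23 = enc_list rows" "length rows = length xs" "rows ! j = enc_list (map enc_bool row)"
    using m j by (simp_all add: rows_def row_def enc_lattice_def comp_def)
  have rowsN: "2 * length xs + 1 \<le> N"
    using dsize_enc_list_ge[of rows] rows size by simp
  have rowN: "dsize (enc_list (map enc_bool row)) \<le> N"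
    using dsize_enc_list_mem[of "rows ! j" rows] nth_mem[of j rows] rows size j by simp
  let ?n = "20 * N + 20"
  let ?loop = "N * (?n + N + 1) + 2"
  define s0 where "s0 = s(26 := enc_nat j)"
  \<comment> \<open>\<open>k\<close> rows remain to be skipped before row \<open>j\<close> is in
    front. Comparing via \<open>drop\<close> avoids recording the rows already passed.\<close>
  define I1 where "I1 k s' \<longleftrightarrow> s' 26 = enc_nat k \<and>
      (\<exists>ys. s' 23 = enc_list ys \<and> drop k ys = drop j rows) \<and> k \<le> N \<and>
      dsize (s' 23) \<le> N \<and> (\<forall>v<20. s' v = s v)" for k and s' :: store
  have loop1: "runs f (Loop (EVar 26) seek_row_com)
      s0 (j * (?n + (2 * N + 1) + 1) + 2) (I1 0)"
  proof (rule runs_Loop_nat)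
    show "I1 j s0"
      using rows size j rowsN by (auto simp: I1_def s0_def)
  next
    fix k s' assume *: "I1 (Suc k) s'"
    then obtain ys where ys: "s' 23 = enc_list ys" "drop (Suc k) ys = drop j rows"
      by (auto simp: I1_def)
    have "drop k (tl ys) = drop j rows" using ys(2) by (simp add: drop_Suc)
    moreover have "dsize (enc_list (tl ys)) \<le> N"
      using * ys(1) dsize_dsnd_le[of "s' 23"] by (auto simp: I1_def)
    ultimately show "s' 26 \<noteq> Leaf \<and> dsize (s' 26) \<le> 2 * N + 1 \<and>
      runs f seek_row_com s' ?n (I1 k)"
      using * ys(1) by (auto simp: I1_def seek_row_com_def)
  qed (auto simp: I1_def)
  \<comment> \<open>The flags are related to the remaining entries rather than the scanned ones:
    what is recorded together with what is left gives the verdict for the whole row, so the empty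
    list yields the answer. \<open>c\<close> is the number of true entries scanned.\<close>
  define I2 where "I2 bs s' \<longleftrightarrow> s' 23 = enc_list (map enc_bool bs) \<and> dsize (s' 23) \<le> N \<and>
      (\<exists>b. s' 24 = enc_bool b \<and> (b \<or> False \<in> set bs \<longleftrightarrow> False \<in> set row)) \<and>
      (\<exists>c. s' 27 = enc_bool (1 \<le> c) \<and> s' 25 = enc_bool (2 \<le> c) \<and>
         c + length (filter id bs) = length (filter id row)) \<and>
      (\<forall>v<20. s' v = s v)" for bs and s' :: store
  have loop2: "runs f (Loop (EVar 23) scan_row_com) s' ?loop (I2 [])" if "I2 row s'" for s'
  proof (rule runs_Loop_list[where I = I2, OF that])
    show "length row \<le> N" using rowsN by (simp add: row_def)
  next
    fix d bs s' assume *: "I2 (d # bs) s'"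
    then obtain b c where bc: "s' 24 = enc_bool b"
      "b \<or> False \<in> set (d # bs) \<longleftrightarrow> False \<in> set row"
      "s' 27 = enc_bool (1 \<le> c)" "s' 25 = enc_bool (2 \<le> c)"
      "c + length (filter id (d # bs)) = length (filter id row)"
      unfolding I2_def by blast
    have bc': "s' 23 = Pair (enc_bool d) (enc_list (map enc_bool bs))"
      "1 + dsize (enc_bool d) + dsize (enc_list (map enc_bool bs)) \<le> N"
      "\<And>v. v < 20 \<Longrightarrow> s' v = s v"
      using * by (auto simp: I2_def)
    note sz = dsize_enc_bool_le[of "1 \<le> c"]
    show "s' 23 \<noteq> Leaf \<and> dsize (s' 23) \<le> N \<and> runs f scan_row_com s' ?n (I2 bs)"
    proof (cases d)
      case True
      have "I2 bs (s'(25 := enc_bool (1 \<le> c), 27 := Pair Leaf Leaf,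
              23 := enc_list (map enc_bool bs)))"
        using bc bc' True unfolding I2_def
        by (auto simp: enc_bool_def intro!: exI[of _ b] exI[of _ "Suc c"])
      then show ?thesis using bc bc' sz True by (auto simp: scan_row_com_def)
    next
      case False
      have "I2 bs (s'(24 := Pair Leaf Leaf, 23 := enc_list (map enc_bool bs)))"
        using bc bc' False unfolding I2_def
        by (auto simp: enc_bool_def intro!: exI[of _ True] exI[of _ c])
      then show ?thesis using bc bc' sz False by (auto simp: scan_row_com_def)
    qed
  qed (auto simp: I2_def)
  let ?Q = "\<lambda>s'. s' 24 = enc_bool (a \<noteq> \<bottom>\<^bsub>L\<^esub>) \<and> s' 25 = enc_bool (a \<noteq> \<top>\<^bsub>L\<^esub>) \<and> (\<forall>v<20. s' v = s v)"
  have Q: "?Q s'" if "I2 [] s'" for s'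
    using that two_le_count_above_iff[OF L xs a] not_le_all_iff[OF L xs a]
    by (auto simp: I2_def row_def)
  have rest: "runs f (Assign 23 (EFst (EVar 23)) ;; Assign 24 ELeaf ;; Assign 25 ELeaf ;;
     Assign 27 ELeaf ;;
     Loop (EVar 23) scan_row_com) s' (2 * N + 10 + ?loop) ?Q" if "I1 0 s'" for s'
  proof -
    from that obtain ys where ys: "s' 23 = enc_list (drop j rows)" "dsize (s' 23) \<le> N"
      "\<And>v. v < 20 \<Longrightarrow> s' v = s v"
      by (auto simp: I1_def)
    moreover have "drop j rows = enc_list (map enc_bool row) # drop (Suc j) rows"
      using j rows by (simp add: Cons_nth_drop_Suc[symmetric])
    ultimately have s': "dfst (s' 23) = enc_list (map enc_bool row)" by simp
    have "I2 row (s'(23 := enc_list (map enc_bool row), 24 := Leaf, 25 := Leaf, 27 := Leaf))"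
      using ys rowN by (auto simp: I2_def enc_bool_def intro: exI[of _ False] exI[of _ 0])
    from loop2[OF this] show ?thesis
      using ys(2) s' rowN by (auto elim!: runs_mono dest: Q)
  qed
  \<comment> \<open>The counter was bounded by \<open>2 * N + 1\<close> instead of \<open>N\<close>.
    Since \<open>2 * j \<le> N\<close>, the halved number of passes pays for a doubled cost per
    pass.\<close>
  have "j * (?n + (2 * N + 1) + 1) + 2 \<le> ?loop + N"
  proof -
    have "j * (?n + (2 * N + 1) + 1) \<le> j * (2 * (?n + N + 1))" by (intro mult_le_mono) auto
    also have "\<dots> = (2 * j) * (?n + N + 1)" by (simp only: ac_simps)
    also have "\<dots> \<le> N * (?n + N + 1)" using j rowsN by (intro mult_le_mono1) auto
    finally show ?thesis by linarith
  qed
  then have "runs f (Loop (EVar 26) seek_row_com ;;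
     Assign 23 (EFst (EVar 23)) ;; Assign 24 ELeaf ;; Assign 25 ELeaf ;;
     Assign 27 ELeaf ;;
     Loop (EVar 23) scan_row_com) s0 (2 * ?loop + 3 * N + 10) ?Q"
    by (intro runs_SeqI[OF runs_mono[OF loop1 order_refl rest]]) auto
  then show ?thesis
    using size rowsN j f
    by (auto simp: compare_com_def compare_time_def loop_time_def s0_def j_def elim!: runs_mono)
qed

section \<open>Checking a pair of tuples\<close>

definition compare_heads_com :: com where
  "compare_heads_com =
     Assign 20 (EVar 14) ;;
     Assign 21 (EFst (EVar 12)) ;;
     Assign 22 (EFst (EVar 13)) ;;
     Assign 23 (EFst (EVar 10)) ;;
     compare_com"

definition lhs_body_com :: com where
  "lhs_body_com =
     compare_heads_com ;;
     Cond (EVar 24) skip_com (Cond (EFst (EVar 11)) (Assign 15 ETrue) skip_com) ;;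
     Assign 10 (ESnd (EVar 10)) ;;
     Assign 11 (ESnd (EVar 11)) ;;
     Assign 12 (ESnd (EVar 12)) ;;
     Assign 13 (ESnd (EVar 13)) ;;
     Assign 14 (EPair ELeaf (EVar 14))"

definition seek_body_com :: com where
  "seek_body_com =
     Assign 10 (ESnd (EVar 10)) ;;
     Assign 12 (ESnd (EVar 12)) ;;
     Assign 13 (ESnd (EVar 13)) ;;
     Assign 14 (ESnd (EVar 14))"

text \<open>Register 14 counts up in the first traversal, as the oracle wants the current position,
  and down in the second, as the distance to \<open>A\<close>. Both traversals consume registers,
  hence the reloading.\<close>

definition pair_com :: com where
  "pair_com =
     Assign 10 (EVar 2) ;;
     Assign 11 (EVar 4) ;;
     Assign 12 (EFst (EVar 7)) ;;
     Assign 13 (EFst (EVar 8)) ;;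
     Assign 14 ELeaf ;;
     Assign 15 ELeaf ;;
     Loop (EVar 10) lhs_body_com ;;
     Assign 10 (EVar 2) ;;
     Assign 12 (EFst (EVar 7)) ;;
     Assign 13 (EFst (EVar 8)) ;;
     Assign 14 (EVar 5) ;;
     Loop (EVar 14) seek_body_com ;;
     Assign 14 (EVar 5) ;;
     compare_heads_com ;;
     Cond (EVar 25) (Cond (EVar 15) skip_com (Assign 0 ELeaf)) skip_com"

definition body_time :: "nat \<Rightarrow> nat" where
  "body_time N = compare_time N + 100 * N + 100"

definition pair_time :: "nat \<Rightarrow> nat" where
  "pair_time N = 2 * loop_time N (body_time N) + body_time N + 100 * N + 100"

section \<open>A fixed encoded input: positions, suffixes and sizes\<close>

locale cfd_input =
  fixes S :: "('a, data, 'l) schema" and us :: "'a list" and ls :: "'a \<Rightarrow> 'l list"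
    and r :: "('a \<Rightarrow> data) set" and ts :: "('a \<Rightarrow> data) list" and X :: "'a set" and A :: 'a
    and f :: oracle_fun
  assumes S: "schema_context S" and r: "relation_over S r" and fd: "fd_over S X A"
    and us: "enumerates us (attrs S)"
    and ls: "\<And>B. B \<in> attrs S \<Longrightarrow> enumerates (ls B) (carrier (lat S B))"
    and ts: "enumerates ts r"
    and f: "cmp_oracle S us ls f"
begin

definition mats :: "'a list \<Rightarrow> data" where
  "mats Bs = enc_list (map (\<lambda>B. enc_lattice (lat S B) (ls B)) Bs)"

definition lhs :: "'a list \<Rightarrow> data" where
  "lhs Bs = enc_list (map (\<lambda>B. enc_bool (B \<in> X)) Bs)"

definition N :: nat where
  "N = dsize (enc_input S us ls ts X A)"

lemma enc_input_eq:
  "enc_input S us ls ts X A = Pair (mats us) (Pair (enc_list (map (enc_tuple us) ts))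
     (Pair (lhs us) (Pair (enc_nat (index_of us A)) Leaf)))"
  by (simp add: enc_input_def mats_def lhs_def)

lemma list_simps [simp]:
  "mats [] = Leaf" "mats (B # Bs) = Pair (enc_lattice (lat S B) (ls B)) (mats Bs)"
  "lhs [] = Leaf" "lhs (B # Bs) = Pair (enc_bool (B \<in> X)) (lhs Bs)"
  "enc_tuple [] t = Leaf" "enc_tuple (B # Bs) t = Pair (t B) (enc_tuple Bs t)"
  by (simp_all add: mats_def lhs_def enc_tuple_def)

lemma attrs_eq: "attrs S = set us" and distinct_us: "distinct us" and r_eq: "r = set ts"
  using us ts by (auto simp: enumerates_def)

lemma A_in: "A \<in> attrs S" and X_sub: "X \<subseteq> attrs S"
  using fd by (auto simp: fd_over_def)

lemma L: "B \<in> attrs S \<Longrightarrow> bounded_lattice (lat S B)"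
  using S by (simp add: schema_context_def)

text \<open>The processed prefix \<open>done\<close> is the ghost variable of the attribute loop;
  its length is the position the oracle expects.\<close>

lemma index_of_us: "us = done @ B # Bs \<Longrightarrow> index_of us B = length done"
  using index_of_nth[OF distinct_us, of "length done"] by simp

lemma size_us: "dsize (mats us) \<le> N" "dsize (lhs us) \<le> N" "2 * length us + 1 \<le> N"
  "dsize (enc_list (map (enc_tuple us) ts)) \<le> N" "2 * length ts + 1 \<le> N"
proof -
  show 1: "dsize (mats us) \<le> N" "dsize (lhs us) \<le> N"
    "dsize (enc_list (map (enc_tuple us) ts)) \<le> N"
    by (simp_all add: N_def enc_input_eq)
  show "2 * length us + 1 \<le> N"
    using 1(1) dsize_enc_list_ge[of "map (\<lambda>B. enc_lattice (lat S B) (ls B)) us"]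
    by (simp add: mats_def)
  show "2 * length ts + 1 \<le> N"
    using 1(3) dsize_enc_list_ge[of "map (enc_tuple us) ts"] by simp
qed

text \<open>Domain values may be arbitrarily large trees, but they occur in the encoded relation, so
  each component of an oracle argument stays within \<open>N\<close>.\<close>

lemma size_suffix:
  assumes "us = done @ Bs"
  shows "dsize (mats Bs) \<le> N" "dsize (lhs Bs) \<le> N" "2 * length done + 1 \<le> N"
    "t \<in> r \<Longrightarrow> dsize (enc_tuple Bs t) \<le> N"
proof -
  show "dsize (mats Bs) \<le> N" "dsize (lhs Bs) \<le> N"
    using dsize_enc_list_map_suffix[of _ Bs "done"] size_us(1,2) unfolding mats_def lhs_def assms
    by (meson le_trans)+
  show "2 * length done + 1 \<le> N" using size_us(3) assms by simp
  assume "t \<in> r"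
  then have "dsize (enc_tuple us t) \<le> dsize (enc_list (map (enc_tuple us) ts))"
    by (intro dsize_enc_list_mem) (simp add: r_eq)
  then show "dsize (enc_tuple Bs t) \<le> N"
    using dsize_enc_list_map_suffix[of t Bs "done"] size_us(4) unfolding enc_tuple_def assms
    by (meson le_trans)
qed

text \<open>The postcondition is a parameter so that resolution with \<open>runs_SeqI\<close> can
  insert the caller's continuation for \<open>Q\<close>.\<close>

lemma runs_compare_heads:
  assumes B: "us = done @ B # Bs" and t: "t1 \<in> r" "t2 \<in> r"
    and s: "s 10 = mats (B # Bs)" "s 12 = enc_tuple (B # Bs) t1"
      "s 13 = enc_tuple (B # Bs) t2" "s 14 = enc_nat (length done)"
    and Q: "\<And>s'. s' 24 = enc_bool (cmp S B (t1 B) (t2 B) \<noteq> \<bottom>\<^bsub>lat S B\<^esub>) \<Longrightarrow>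
        s' 25 = enc_bool (cmp S B (t1 B) (t2 B) \<noteq> \<top>\<^bsub>lat S B\<^esub>) \<Longrightarrow>
        (\<And>v. v < 20 \<Longrightarrow> s' v = s v) \<Longrightarrow> Q s'"
  shows "runs f compare_heads_com s (compare_time N + 10 * N + 10) Q"
proof -
  have BS: "B \<in> attrs S" using B by (simp add: attrs_eq)
  note sz = size_suffix[OF B]
  let ?a = "cmp S B (t1 B) (t2 B)"
  let ?s = "s(20 := enc_nat (length done), 21 := t1 B, 22 := t2 B,
    23 := enc_lattice (lat S B) (ls B))"
  have v: "t1 B \<in> vals S B" "t2 B \<in> vals S B"
    using relation_over_vals[OF r _ BS] t by auto
  have "runs f compare_com ?s (compare_time N) (\<lambda>s'. s' 24 = enc_bool (?a \<noteq> \<bottom>\<^bsub>lat S B\<^esub>) \<and>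
      s' 25 = enc_bool (?a \<noteq> \<top>\<^bsub>lat S B\<^esub>) \<and> (\<forall>v<20. s' v = ?s v))"
    using f BS v index_of_us[OF B] sz(1) sz(3) sz(4)[OF t(1)] sz(4)[OF t(2)]
    by (intro runs_compare[OF L[OF BS] ls[OF BS] cmp_in_carrier[OF S BS v]])
       (auto simp: cmp_oracle_def)
  then show ?thesis
    using s sz(1) sz(3) sz(4)[OF t(1)] sz(4)[OF t(2)]
    by (auto simp: compare_heads_com_def elim!: runs_mono intro!: Q)
qed

definition violated :: "('a \<Rightarrow> data) \<Rightarrow> ('a \<Rightarrow> data) \<Rightarrow> bool" where
  "violated t1 t2 \<longleftrightarrow>
     \<not> (\<exists>B\<in>X. cmp S B (t1 B) (t2 B) = \<bottom>\<^bsub>lat S B\<^esub>) \<and> cmp S A (t1 A) (t2 A) \<noteq> \<top>\<^bsub>lat S A\<^esub>"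

lemma runs_pair:
  assumes t: "t1 \<in> r" "t2 \<in> r"
    and s: "s 2 = mats us" "s 4 = lhs us" "s 5 = enc_nat (index_of us A)"
      "dfst (s 7) = enc_tuple us t1" "dsize (s 7) \<le> N"
      "dfst (s 8) = enc_tuple us t2" "dsize (s 8) \<le> N"
    and Q: "\<And>s'. s' 0 = (if violated t1 t2 then Leaf else s 0) \<Longrightarrow>
        (\<And>v. 0 < v \<Longrightarrow> v < 10 \<Longrightarrow> s' v = s v) \<Longrightarrow> Q s'"
  shows "runs f pair_com s (pair_time N) Q"
proof -
  let ?bot = "\<lambda>B. cmp S B (t1 B) (t2 B) = \<bottom>\<^bsub>lat S B\<^esub>"
  note sz = size_us size_suffix(4)[of "[]" us, simplified, OF t(1)]
    size_suffix(4)[of "[]" us, simplified, OF t(2)]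
  define I where "I Bs s' \<longleftrightarrow> s' 10 = mats Bs \<and> s' 11 = lhs Bs \<and>
      s' 12 = enc_tuple Bs t1 \<and> s' 13 = enc_tuple Bs t2 \<and>
      (\<exists>done. us = done @ Bs \<and> s' 14 = enc_nat (length done)) \<and>
      (\<exists>b. s' 15 = enc_bool b \<and> (b \<or> (\<exists>B\<in>X \<inter> set Bs. ?bot B) \<longleftrightarrow> (\<exists>B\<in>X. ?bot B))) \<and>
      (\<forall>v<10. s' v = s v)" for Bs and s' :: store
  have lhs_loop: "runs f (Loop (EVar 10) lhs_body_com) s' (loop_time N (body_time N)) (I [])"
    if "I us s'" for s'
    unfolding loop_time_def
  proof (rule runs_Loop_list[where I = I, OF that])
    show "length us \<le> N" using sz by simp
  next
    fix B Bs s' assume *: "I (B # Bs) s'"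
    then obtain "done" b where B: "us = done @ B # Bs" "s' 14 = enc_nat (length done)"
      "s' 15 = enc_bool b" "b \<or> (\<exists>B\<in>X \<inter> set (B # Bs). ?bot B) \<longleftrightarrow> (\<exists>B\<in>X. ?bot B)"
      "s' 10 = mats (B # Bs)" "s' 11 = lhs (B # Bs)"
      "s' 12 = enc_tuple (B # Bs) t1" "s' 13 = enc_tuple (B # Bs) t2"
      "\<And>v. v < 10 \<Longrightarrow> s' v = s v"
      unfolding I_def by blast
    note szB = size_suffix(1-3)[OF B(1)] size_suffix(4)[OF B(1) t(1)] size_suffix(4)[OF B(1) t(2)]
    have us': "us = (done @ [B]) @ Bs" using B by simp
    \<comment> \<open>With the ghost variables instantiated here once, the symbolic execution below
      only has to establish register equations.\<close>
    have inv: "I Bs s''" if "s'' 10 = mats Bs" "s'' 11 = lhs Bs"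
      "s'' 12 = enc_tuple Bs t1" "s'' 13 = enc_tuple Bs t2" "s'' 14 = enc_nat (Suc (length done))"
      "s'' 15 = enc_bool (b \<or> B \<in> X \<and> ?bot B)" "\<And>v. v < 10 \<Longrightarrow> s'' v = s v" for s''
      unfolding I_def using that us' B(4)
      by (intro conjI exI[of _ "done @ [B]"] exI[of _ "b \<or> B \<in> X \<and> ?bot B"]) auto
    have "runs f lhs_body_com s' (body_time N) (I Bs)"
      unfolding lhs_body_com_def
    \<comment> \<open>What \<open>body_time\<close> leaves after the comparison of the
      heads.\<close>
    proof (rule runs_SeqI[where k = "90 * N + 90"])
      show "runs f compare_heads_com s' (compare_time N + 10 * N + 10)
        (\<lambda>s'. runs f (Cond (EVar 24) skip_com (Cond (EFst (EVar 11)) (Assign 15 ETrue) skip_com) ;;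
         Assign 10 (ESnd (EVar 10)) ;; Assign 11 (ESnd (EVar 11)) ;;
         Assign 12 (ESnd (EVar 12)) ;; Assign 13 (ESnd (EVar 13)) ;;
         Assign 14 (EPair ELeaf (EVar 14))) s' (90 * N + 90) (I Bs))"
      proof (rule runs_compare_heads[OF B(1) t])
        fix s'' assume s'': "s'' 24 = enc_bool (cmp S B (t1 B) (t2 B) \<noteq> \<bottom>\<^bsub>lat S B\<^esub>)"
          "\<And>v. v < 20 \<Longrightarrow> s'' v = s' v"
        show "runs f (Cond (EVar 24) skip_com
            (Cond (EFst (EVar 11)) (Assign 15 ETrue) skip_com) ;;
         Assign 10 (ESnd (EVar 10)) ;; Assign 11 (ESnd (EVar 11)) ;;
         Assign 12 (ESnd (EVar 12)) ;; Assign 13 (ESnd (EVar 13)) ;;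
         Assign 14 (EPair ELeaf (EVar 14))) s'' (90 * N + 90) (I Bs)"
          using B szB s''(1) dsize_enc_bool_le[of "cmp S B (t1 B) (t2 B) \<noteq> \<bottom>\<^bsub>lat S B\<^esub>"]
          by (auto simp: s''(2) enc_bool_def intro!: inv)
      qed (use B in auto)
    qed (simp add: body_time_def)
    then show "s' 10 \<noteq> Leaf \<and> dsize (s' 10) \<le> N \<and> runs f lhs_body_com s' (body_time N) (I Bs)"
      using B szB by simp
  qed (auto simp: I_def)

  obtain as bs where A: "us = as @ A # bs"
    using A_in by (auto simp: attrs_eq in_set_conv_decomp)
  \<comment> \<open>\<open>k\<close> more steps expose \<open>A\<close>. The splitting
    \<open>us = cs @ ds\<close> is kept for the size bounds on the suffix \<open>ds\<close>.\<close>
  define J where "J k s' \<longleftrightarrow> s' 14 = enc_nat k \<and>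
      (\<exists>cs ds. us = cs @ ds \<and> drop k ds = A # bs \<and> s' 10 = mats ds \<and> s' 12 = enc_tuple ds t1 \<and>
        s' 13 = enc_tuple ds t2) \<and> k \<le> N \<and>
      s' 15 = enc_bool (\<exists>B\<in>X. ?bot B) \<and> (\<forall>v<10. s' v = s v)" for k and s' :: store
  have seek_loop: "runs f (Loop (EVar 14) seek_body_com) s'
      (length as * (20 * N + 20 + (2 * N + 1) + 1) + 2) (J 0)" if "J (length as) s'" for s'
  proof (rule runs_Loop_nat[where I = J, OF that])
    fix k s' assume *: "J (Suc k) s'"
    then obtain cs ds where ds: "us = cs @ ds" "drop (Suc k) ds = A # bs" "s' 10 = mats ds"
      "s' 12 = enc_tuple ds t1" "s' 13 = enc_tuple ds t2" "s' 14 = enc_nat (Suc k)"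
      "s' 15 = enc_bool (\<exists>B\<in>X. ?bot B)" "\<And>v. v < 10 \<Longrightarrow> s' v = s v" "Suc k \<le> N"
      unfolding J_def by blast
    then obtain D Ds where D: "ds = D # Ds" by (cases ds) auto
    note szB = size_suffix[OF ds(1)]
    have "us = (cs @ [D]) @ Ds" using ds D by simp
    then have inv: "J k s''" if "s'' 10 = mats Ds" "s'' 12 = enc_tuple Ds t1"
      "s'' 13 = enc_tuple Ds t2" "s'' 14 = enc_nat k" "s'' 15 = s' 15"
      "\<And>v. v < 10 \<Longrightarrow> s'' v = s v" for s''
      unfolding J_def using that ds D
      by (intro conjI exI[of _ "cs @ [D]"] exI[of _ Ds]) auto
    show "s' 14 \<noteq> Leaf \<and> dsize (s' 14) \<le> 2 * N + 1 \<and>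
        runs f seek_body_com s' (20 * N + 20) (J k)"
      using ds D szB(1) szB(4)[OF t(1)] szB(4)[OF t(2)]
      by (auto simp: seek_body_com_def intro!: inv)
  qed (auto simp: J_def)

  have final: "runs f (Assign 14 (EVar 5) ;; compare_heads_com ;;
      Cond (EVar 25) (Cond (EVar 15) skip_com (Assign 0 ELeaf)) skip_com) s'
      (body_time N) Q" if "J 0 s'" for s'
  proof -
    from that have s': "s' 10 = mats (A # bs)" "s' 12 = enc_tuple (A # bs) t1"
      "s' 13 = enc_tuple (A # bs) t2" "s' 15 = enc_bool (\<exists>B\<in>X. ?bot B)"
      "\<And>v. v < 10 \<Longrightarrow> s' v = s v"
      unfolding J_def by auto
    have len: "2 * length as + 1 \<le> N" using size_suffix(3)[OF A] .
    have "runs f (compare_heads_com ;;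
        Cond (EVar 25) (Cond (EVar 15) skip_com (Assign 0 ELeaf)) skip_com)
        (s'(14 := enc_nat (length as))) (compare_time N + 10 * N + 10 + 20) Q"
    proof (rule runs_SeqI[OF runs_compare_heads[OF A t] order_refl])
      fix s'' assume s'': "s'' 25 = enc_bool (cmp S A (t1 A) (t2 A) \<noteq> \<top>\<^bsub>lat S A\<^esub>)"
          "\<And>v. v < 20 \<Longrightarrow> s'' v = (s'(14 := enc_nat (length as))) v"
      have Q': "Q z" if "z 0 = (if violated t1 t2 then Leaf else s 0)"
        "\<And>v. 0 < v \<Longrightarrow> v < 10 \<Longrightarrow> z v = s'' v" for z
        using that s''(2) s'(5) by (intro Q) auto
      show "runs f (Cond (EVar 25) (Cond (EVar 15) skip_com (Assign 0 ELeaf)) skip_com)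
          s'' 20 Q"
        using s''(1) s'(4) s'(5)[of 0]
          dsize_enc_bool_le[of "cmp S A (t1 A) (t2 A) \<noteq> \<top>\<^bsub>lat S A\<^esub>"]
          dsize_enc_bool_le[of "\<exists>B\<in>X. ?bot B"]
        by (auto simp: s''(2) violated_def intro!: Q')
    qed (use s' in auto)
    then show ?thesis
      using s'(5)[of 5] s(3) index_of_us[OF A] len
      by (auto simp: body_time_def elim!: runs_mono)
  qed

  \<comment> \<open>The cheap seek loop gets the allowance of the comparison loop, so
    \<open>pair_time\<close> is two equal loops plus one comparison.\<close>
  have seek_time: "length as * (20 * N + 20 + (2 * N + 1) + 1) + 2 \<le> loop_time N (body_time N)"
    using size_suffix(3)[OF A] unfolding loop_time_def body_time_def
    by (intro add_mono[OF mult_le_mono order_refl]) auto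
  have mid: "runs f (Assign 10 (EVar 2) ;; Assign 12 (EFst (EVar 7)) ;;
     Assign 13 (EFst (EVar 8)) ;; Assign 14 (EVar 5) ;;
     Loop (EVar 14) seek_body_com ;; Assign 14 (EVar 5) ;; compare_heads_com ;;
     Cond (EVar 25) (Cond (EVar 15) skip_com (Assign 0 ELeaf)) skip_com) s'
     (50 * N + 50 + (loop_time N (body_time N) + body_time N)) Q" if "I [] s'" for s'
  proof -
    from that have s': "s' 15 = enc_bool (\<exists>B\<in>X. ?bot B)" "\<And>v. v < 10 \<Longrightarrow> s' v = s v"
      unfolding I_def by auto
    let ?s = "s'(10 := mats us, 12 := enc_tuple us t1, 13 := enc_tuple us t2,
      14 := enc_nat (length as))"
    have "J (length as) ?s"
      unfolding J_def using s' A size_suffix(3)[OF A]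
      by (intro conjI exI[of _ "[]"] exI[of _ us]) auto
    then have "runs f (Loop (EVar 14) seek_body_com ;; Assign 14 (EVar 5) ;; compare_heads_com ;;
       Cond (EVar 25) (Cond (EVar 15) skip_com (Assign 0 ELeaf)) skip_com) ?s
       (loop_time N (body_time N) + body_time N) Q"
      by (intro runs_SeqI[OF runs_mono[OF seek_loop seek_time final]]) auto
    then show ?thesis
      using s'(2) s sz index_of_us[OF A] size_suffix(3)[OF A]
      by (auto elim!: runs_mono)
  qed

  let ?s = "s(10 := mats us, 11 := lhs us, 12 := enc_tuple us t1, 13 := enc_tuple us t2,
    14 := Leaf, 15 := Leaf)"
  \<comment> \<open>Initially nothing is recorded and all of \<open>us\<close> is left, which covers
    \<open>X\<close> because \<open>X\<close> consists of attributes.\<close>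
  have "I us ?s"
    unfolding I_def using X_sub
    by (intro conjI exI[of _ "[]"] exI[of _ False]) (auto simp: enc_bool_def attrs_eq)
  then have "runs f (Loop (EVar 10) lhs_body_com ;;
     Assign 10 (EVar 2) ;; Assign 12 (EFst (EVar 7)) ;;
     Assign 13 (EFst (EVar 8)) ;; Assign 14 (EVar 5) ;;
     Loop (EVar 14) seek_body_com ;; Assign 14 (EVar 5) ;; compare_heads_com ;;
     Cond (EVar 25) (Cond (EVar 15) skip_com (Assign 0 ELeaf)) skip_com) ?s
     (loop_time N (body_time N) + (50 * N + 50 + (loop_time N (body_time N) + body_time N))) Q"
    by (intro runs_SeqI[OF runs_mono[OF lhs_loop order_refl mid]]) auto
  then show ?thesis
    using s sz by (auto simp: pair_com_def pair_time_def elim!: runs_mono)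
qed

end

section \<open>The decision procedure\<close>

definition trivial_body_com :: com where
  "trivial_body_com =
     Cond (ESnd (EFst (EVar 7))) skip_com (Assign 6 ETrue) ;;
     Assign 7 (ESnd (EVar 7))"

definition inner_body_com :: com where
  "inner_body_com = pair_com ;; Assign 8 (ESnd (EVar 8))"

definition outer_body_com :: com where
  "outer_body_com =
     Assign 8 (EVar 3) ;;
     Loop (EVar 8) inner_body_com ;;
     Assign 7 (ESnd (EVar 7))"

text \<open>Register 0 is both input and verdict, so its components are copied out first. Pairs can
  only lower the verdict; register 6 overrides it at the end, mirroring the disjunction in the
  criterion.\<close>

definition cfd_com :: com where
  "cfd_com =
     Assign 2 (EFst (EVar 0)) ;;
     Assign 3 (EFst (ESnd (EVar 0))) ;;
     Assign 4 (EFst (ESnd (ESnd (EVar 0)))) ;;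
     Assign 5 (EFst (ESnd (ESnd (ESnd (EVar 0))))) ;;
     Assign 6 ELeaf ;;
     Assign 7 (EVar 2) ;;
     Loop (EVar 7) trivial_body_com ;;
     Assign 0 ETrue ;;
     Assign 7 (EVar 3) ;;
     Loop (EVar 7) outer_body_com ;;
     Cond (EVar 6) (Assign 0 ETrue) skip_com"

definition cfd_time :: "nat \<Rightarrow> nat" where
  "cfd_time N = loop_time N (20 * N + 20) +
     loop_time N (loop_time N (pair_time N + 20 * N + 20) + 20 * N + 20) + 100 * N + 100"

text \<open>Coinciding bounds squeeze all elements together, leaving a matrix with one row;
  triviality is visible without reading an entry.\<close>

lemma enc_lattice_trivial_iff:
  assumes "bounded_lattice L" "enumerates xs (carrier L)"
  shows "dsnd (enc_lattice L xs) = Leaf \<longleftrightarrow> \<bottom>\<^bsub>L\<^esub> = \<top>\<^bsub>L\<^esub>"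
proof -
  interpret bounded_lattice L by fact
  have xs: "distinct xs" "set xs = carrier L"
    using assms by (auto simp: enumerates_def)
  have "dsnd (enc_lattice L xs) = Leaf \<longleftrightarrow> tl xs = []"
    by (simp add: enc_lattice_def map_tl[symmetric])
  also have "\<dots> \<longleftrightarrow> card (carrier L) \<le> 1"
    using xs distinct_card[of xs] by (cases xs) auto
  also have "\<dots> \<longleftrightarrow> \<bottom>\<^bsub>L\<^esub> = \<top>\<^bsub>L\<^esub>"
  proof
    assume "card (carrier L) \<le> 1"
    moreover have "finite (carrier L)" using xs(2) by (metis finite_set)
    ultimately show "\<bottom>\<^bsub>L\<^esub> = \<top>\<^bsub>L\<^esub>"
      using card_le_Suc0_iff_eq by (metis One_nat_def bottom_closed top_closed)
  next
    assume eq: "\<bottom>\<^bsub>L\<^esub> = \<top>\<^bsub>L\<^esub>"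
    then have "carrier L \<subseteq> {\<top>\<^bsub>L\<^esub>}"
      by (metis bottom_lower le_antisym subsetI singletonI top_closed top_higher)
    then show "card (carrier L) \<le> 1"
      using card_mono[of "{\<top>\<^bsub>L\<^esub>}" "carrier L"] by simp
  qed
  finally show ?thesis .
qed

context cfd_input
begin

lemma runs_trivial_loop:
  assumes s: "s 6 = Leaf" "s 7 = mats us"
    and Q: "\<And>s'. s' 6 = enc_bool (\<exists>B\<in>attrs S. \<bottom>\<^bsub>lat S B\<^esub> = \<top>\<^bsub>lat S B\<^esub>) \<Longrightarrow>
      (\<And>v. v < 6 \<Longrightarrow> s' v = s v) \<Longrightarrow> Q s'"
  shows "runs f (Loop (EVar 7)
      trivial_body_com) s (loop_time N (20 * N + 20)) Q"
proof -
  let ?triv = "\<lambda>B. \<bottom>\<^bsub>lat S B\<^esub> = \<top>\<^bsub>lat S B\<^esub>"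
  define I where "I Bs s' \<longleftrightarrow> s' 7 = mats Bs \<and> (\<exists>done. us = done @ Bs) \<and>
    (\<exists>b. s' 6 = enc_bool b \<and> (b \<or> (\<exists>B\<in>set Bs. ?triv B) \<longleftrightarrow> (\<exists>B\<in>attrs S. ?triv B))) \<and>
    (\<forall>v<6. s' v = s v)" for Bs and s' :: store
  have "runs f (Loop (EVar 7)
      trivial_body_com) s (loop_time N (20 * N + 20)) (I [])"
    unfolding loop_time_def
  proof (rule runs_Loop_list[where I = I])
    show "I us s"
      unfolding I_def using s attrs_eq
      by (intro conjI exI[of _ "[]"] exI[of _ False]) (auto simp: enc_bool_def)
    show "length us \<le> N" using size_us by simp
  next
    fix B Bs s' assume "I (B # Bs) s'"
    then obtain "done" b where B: "us = done @ B # Bs" "s' 7 = mats (B # Bs)" "s' 6 = enc_bool b"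
      "b \<or> (\<exists>B\<in>set (B # Bs). ?triv B) \<longleftrightarrow> (\<exists>B\<in>attrs S. ?triv B)"
      "\<And>v. v < 6 \<Longrightarrow> s' v = s v"
      unfolding I_def by blast
    have BS: "B \<in> attrs S" using B by (simp add: attrs_eq)
    have us': "us = (done @ [B]) @ Bs" using B by simp
    have inv: "I Bs s''" if "s'' 7 = mats Bs" "s'' 6 = enc_bool (b \<or> ?triv B)"
      "\<And>v. v < 6 \<Longrightarrow> s'' v = s v" for s''
      unfolding I_def using that us' B(4)
      by (intro conjI exI[of _ "done @ [B]"] exI[of _ "b \<or> ?triv B"]) auto
    show "s' 7 \<noteq> Leaf \<and> dsize (s' 7) \<le> N \<and>
      runs f trivial_body_com s' (20 * N + 20) (I Bs)"
      using B size_suffix(1)[OF B(1)] enc_lattice_trivial_iff[OF L[OF BS] ls[OF BS]]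
        dsize_dsnd_le[of "enc_lattice (lat S B) (ls B)"]
      by (auto simp: trivial_body_com_def enc_bool_def intro!: inv)
  qed (auto simp: I_def)
  then show ?thesis
    by (rule runs_mono) (auto simp: I_def intro!: Q)
qed

definition rels :: "('a \<Rightarrow> data) list \<Rightarrow> data" where
  "rels rs = enc_list (map (enc_tuple us) rs)"

lemma rels_simps [simp]:
  "rels [] = Leaf" "rels (t # rs) = Pair (enc_tuple us t) (rels rs)"
  by (simp_all add: rels_def)

lemma size_rels_suffix: "ts = done @ rs \<Longrightarrow> dsize (rels rs) \<le> N"
  using dsize_enc_list_map_suffix[of "enc_tuple us" rs "done"] size_us(4)
  by (metis le_trans rels_def)

text \<open>The incoming verdict \<open>b\<close> is arbitrary because it accumulates over earlier
  first tuples. The frame includes register 7, on which the outer loop runs.\<close>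

lemma runs_inner_loop:
  assumes t1: "t1 \<in> r"
    and s: "s 0 = enc_bool b" "s 2 = mats us" "s 3 = rels ts" "s 4 = lhs us"
      "s 5 = enc_nat (index_of us A)" "dfst (s 7) = enc_tuple us t1" "dsize (s 7) \<le> N"
      "s 8 = rels ts"
    and Q: "\<And>s'. s' 0 = enc_bool (b \<and> (\<forall>t2\<in>r. \<not> violated t1 t2)) \<Longrightarrow>
      (\<And>v. 0 < v \<Longrightarrow> v < 8 \<Longrightarrow> s' v = s v) \<Longrightarrow> Q s'"
  shows "runs f (Loop (EVar 8) inner_body_com) s
      (loop_time N (pair_time N + 20 * N + 20)) Q"
proof -
  define I where "I rs s' \<longleftrightarrow> s' 8 = rels rs \<and> (\<exists>done. ts = done @ rs) \<and>
    (\<exists>b'. s' 0 = enc_bool b' \<and> (b' \<and> (\<forall>t2\<in>set rs. \<not> violated t1 t2) \<longleftrightarrow>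
       b \<and> (\<forall>t2\<in>r. \<not> violated t1 t2))) \<and>
    (\<forall>v. 0 < v \<and> v < 8 \<longrightarrow> s' v = s v)" for rs and s' :: store
  have "runs f (Loop (EVar 8) inner_body_com) s
      (loop_time N (pair_time N + 20 * N + 20)) (I [])"
    unfolding loop_time_def
  proof (rule runs_Loop_list[where I = I])
    show "I ts s"
      unfolding I_def using s r_eq by (intro conjI exI[of _ "[]"] exI[of _ b]) auto
    show "length ts \<le> N" using size_us by simp
  next
    fix t2 rs s' assume "I (t2 # rs) s'"
    then obtain "done" b' where *: "ts = done @ t2 # rs" "s' 8 = rels (t2 # rs)"
      "s' 0 = enc_bool b'" "b' \<and> (\<forall>t2\<in>set (t2 # rs). \<not> violated t1 t2) \<longleftrightarrow>
       b \<and> (\<forall>t2\<in>r. \<not> violated t1 t2)"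
      "\<And>v. 0 < v \<Longrightarrow> v < 8 \<Longrightarrow> s' v = s v"
      unfolding I_def by blast
    have t2: "t2 \<in> r" using * by (simp add: r_eq)
    have ts': "ts = (done @ [t2]) @ rs" using * by simp
    have inv: "I rs s''" if "s'' 8 = rels rs" "s'' 0 = (if violated t1 t2 then Leaf else s' 0)"
      "\<And>v. 0 < v \<Longrightarrow> v < 8 \<Longrightarrow> s'' v = s v" for s''
      unfolding I_def using that ts' *(3,4)
      by (intro conjI exI[of _ "done @ [t2]"] exI[of _ "b' \<and> \<not> violated t1 t2"])
         (auto simp: enc_bool_def)
    have "runs f inner_body_com s'
        (pair_time N + (20 * N + 20)) (I rs)"
      unfolding inner_body_com_def
    proof (rule runs_SeqI[OF runs_pair[OF t1 t2] order_refl])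
      fix s'' assume s'': "s'' 0 = (if violated t1 t2 then Leaf else s' 0)"
        "\<And>v. 0 < v \<Longrightarrow> v < 10 \<Longrightarrow> s'' v = s' v"
      show "runs f (Assign 8 (ESnd (EVar 8))) s'' (20 * N + 20) (I rs)"
        using * s'' size_rels_suffix[OF *(1)] by (auto intro!: inv)
    qed (use * s size_rels_suffix[OF *(1)] in auto)
    then show "s' 8 \<noteq> Leaf \<and> dsize (s' 8) \<le> N \<and>
        runs f inner_body_com s' (pair_time N + 20 * N + 20) (I rs)"
      using * size_rels_suffix[OF *(1)] by (simp add: add.assoc)
  qed (auto simp: I_def)
  then show ?thesis
    by (rule runs_mono) (auto simp: I_def intro!: Q)
qed

lemma runs_outer_loop:
  assumes s: "s 0 = enc_bool True" "s 2 = mats us" "s 3 = rels ts" "s 4 = lhs us"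
      "s 5 = enc_nat (index_of us A)" "s 7 = rels ts"
    and Q: "\<And>s'. s' 0 = enc_bool (\<forall>t1\<in>r. \<forall>t2\<in>r. \<not> violated t1 t2) \<Longrightarrow>
      s' 6 = s 6 \<Longrightarrow> Q s'"
  shows "runs f (Loop (EVar 7) outer_body_com) s
      (loop_time N (loop_time N (pair_time N + 20 * N + 20) + 20 * N + 20)) Q"
proof -
  let ?ok = "\<lambda>t1. \<forall>t2\<in>r. \<not> violated t1 t2"
  let ?T = "loop_time N (pair_time N + 20 * N + 20)"
  define I where "I rs s' \<longleftrightarrow> s' 7 = rels rs \<and> (\<exists>done. ts = done @ rs) \<and>
    (\<exists>b. s' 0 = enc_bool b \<and> (b \<and> (\<forall>t1\<in>set rs. ?ok t1) \<longleftrightarrow> (\<forall>t1\<in>r. ?ok t1))) \<and>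
    (\<forall>v. 0 < v \<and> v < 7 \<longrightarrow> s' v = s v)" for rs and s' :: store
  have "runs f (Loop (EVar 7) outer_body_com) s (loop_time N (?T + 20 * N + 20)) (I [])"
    unfolding loop_time_def[of N "?T + 20 * N + 20"]
  proof (rule runs_Loop_list[where I = I])
    show "I ts s"
      unfolding I_def using s r_eq by (intro conjI exI[of _ "[]"] exI[of _ True]) auto
    show "length ts \<le> N" using size_us by simp
  next
    fix t1 rs s' assume "I (t1 # rs) s'"
    then obtain "done" b where *: "ts = done @ t1 # rs" "s' 7 = rels (t1 # rs)"
      "s' 0 = enc_bool b" "b \<and> (\<forall>t1\<in>set (t1 # rs). ?ok t1) \<longleftrightarrow> (\<forall>t1\<in>r. ?ok t1)"
      "\<And>v. 0 < v \<Longrightarrow> v < 7 \<Longrightarrow> s' v = s v"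
      unfolding I_def by blast
    have t1: "t1 \<in> r" using * by (simp add: r_eq)
    have ts': "ts = (done @ [t1]) @ rs" using * by simp
    have inv: "I rs s''" if "s'' 7 = rels rs" "s'' 0 = enc_bool (b \<and> ?ok t1)"
      "\<And>v. 0 < v \<Longrightarrow> v < 7 \<Longrightarrow> s'' v = s v" for s''
      unfolding I_def using that ts' *(4)
      by (intro conjI exI[of _ "done @ [t1]"] exI[of _ "b \<and> ?ok t1"]) auto
    have "runs f (Loop (EVar 8) inner_body_com ;;
        Assign 7 (ESnd (EVar 7))) (s'(8 := rels ts)) (?T + (10 * N + 10)) (I rs)"
    proof (rule runs_SeqI[OF runs_inner_loop[OF t1, where b = b] order_refl])
      fix s'' assume s'': "s'' 0 = enc_bool (b \<and> ?ok t1)"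
        "\<And>v. 0 < v \<Longrightarrow> v < 8 \<Longrightarrow> s'' v = (s'(8 := rels ts)) v"
      show "runs f (Assign 7 (ESnd (EVar 7))) s'' (10 * N + 10) (I rs)"
        using * s'' size_rels_suffix[OF *(1)] by (auto intro!: inv)
    qed (use * s size_rels_suffix[OF *(1)] in auto)
    then show "s' 7 \<noteq> Leaf \<and> dsize (s' 7) \<le> N \<and>
        runs f outer_body_com s' (?T + 20 * N + 20) (I rs)"
      using * s size_rels_suffix[OF *(1)] size_rels_suffix[of "[]" ts]
      by (auto simp: outer_body_com_def elim!: runs_mono)
  qed (auto simp: I_def)
  then show ?thesis
    by (rule runs_mono) (auto simp: I_def intro!: Q)
qed

lemma cfd_com_correct:
  "decides_within cfd_com f (enc_input S us ls ts X A) (cfd_time N) (certain_fd S r X A)"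
proof -
  let ?s = "initial_store (enc_input S us ls ts X A)"
  let ?triv = "\<exists>B\<in>attrs S. \<bottom>\<^bsub>lat S B\<^esub> = \<top>\<^bsub>lat S B\<^esub>"
  let ?ok = "\<forall>t1\<in>r. \<forall>t2\<in>r. \<not> violated t1 t2"
  let ?Q = "\<lambda>s'. s' 0 = enc_bool (certain_fd S r X A)"
  let ?T = "loop_time N (loop_time N (pair_time N + 20 * N + 20) + 20 * N + 20)"
  have certain: "certain_fd S r X A \<longleftrightarrow> ?triv \<or> ?ok"
    unfolding certain_fd_iff[OF S r fd] violated_def by blast
  define s0 where "s0 = ?s(2 := mats us, 3 := rels ts, 4 := lhs us, 5 := enc_nat (index_of us A),
    6 := Leaf, 7 := mats us)"
  have last: "runs f (Loop (EVar 7) outer_body_com ;; Cond (EVar 6) (Assign 0 ETrue) skip_com) s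
      (?T + 10) ?Q"
    if "s 0 = enc_bool True" "s 2 = mats us" "s 3 = rels ts" "s 4 = lhs us"
      "s 5 = enc_nat (index_of us A)" "s 7 = rels ts" "s 6 = enc_bool ?triv" for s
  proof (rule runs_SeqI[OF runs_outer_loop order_refl])
    fix s' :: store assume "s' 0 = enc_bool ?ok" "s' 6 = s 6"
    then show "runs f (Cond (EVar 6) (Assign 0 ETrue) skip_com) s' 10 ?Q"
      using certain that dsize_enc_bool_le[of ?triv] by (auto simp: enc_bool_def)
  qed (use that in auto)
  have mid: "runs f (Loop (EVar 7)
        trivial_body_com ;;
      Assign 0 ETrue ;; Assign 7 (EVar 3) ;; Loop (EVar 7) outer_body_com ;;
      Cond (EVar 6) (Assign 0 ETrue) skip_com) s0
      (loop_time N (20 * N + 20) + (?T + 10 * N + 30)) ?Q"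
  proof (rule runs_SeqI[OF runs_trivial_loop order_refl])
    fix s' assume s': "s' 6 = enc_bool ?triv" "\<And>v. v < 6 \<Longrightarrow> s' v = s0 v"
    have "runs f (Loop (EVar 7) outer_body_com ;; Cond (EVar 6) (Assign 0 ETrue) skip_com)
       (s'(0 := Pair Leaf Leaf, 7 := rels ts)) (?T + 10) ?Q"
      using s' by (intro last) (auto simp: s0_def enc_bool_def)
    then show "runs f (Assign 0 ETrue ;; Assign 7 (EVar 3) ;; Loop (EVar 7) outer_body_com ;;
      Cond (EVar 6) (Assign 0 ETrue) skip_com) s' (?T + 10 * N + 30) ?Q"
      using s'(2)[of 3] size_rels_suffix[of "[]" ts] by (auto simp: s0_def elim!: runs_mono)
  qed (simp_all add: s0_def)
  \<comment> \<open>The 5 counts the four pair nodes and the closing leaf of the component list; the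
    equation bounds all projections of the input at once.\<close>
  have sum: "dsize (mats us) + dsize (rels ts) + dsize (lhs us) + dsize (enc_nat (index_of us A)) + 5 = N"
    by (simp add: N_def enc_input_eq rels_def)
  have "runs f cfd_com ?s (cfd_time N) ?Q"
    unfolding cfd_com_def cfd_time_def enc_input_eq
    using mid sum
    by (auto simp: initial_store_def s0_def enc_input_eq rels_def[symmetric] elim!: runs_mono)
  then show ?thesis
    unfolding decides_within_def runs_def .
qed

end

section \<open>Polynomiality of the time bound\<close>

lemma cfd_time_poly: "\<exists>p :: nat poly. \<forall>n. poly p n = cfd_time n"
proof -
  let ?x = "[:0, 1:] :: nat poly"
  \<comment> \<open>Polynomials are closed under \<open>loop_time\<close>, so the bound is composed
    along the nesting of loops and never multiplied out.\<close>
  have loop: "\<exists>q. \<forall>n. poly q n = loop_time n (poly p n)" for p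
    by (intro exI[of _ "?x * (p + ?x + 1) + 2"]) (simp add: loop_time_def)
  obtain c where c: "\<And>n. poly c n = loop_time n (20 * n + 20)"
    using loop[of "20 * ?x + 20"] by (auto simp: mult.commute)
  \<comment> \<open>120 is 20 from \<open>compare_time\<close> plus 100 from
    \<open>body_time\<close>; in \<open>?q\<close> it is 100 from \<open>pair_time\<close> plus 20
    from the inner loop body.\<close>
  let ?b = "2 * c + 120 * ?x + 120"
  have b: "poly ?b n = body_time n" for n
    by (simp add: c body_time_def compare_time_def)
  obtain d where d: "\<And>n. poly d n = loop_time n (body_time n)"
    using loop[of ?b] unfolding b by auto
  let ?q = "2 * d + ?b + 120 * ?x + 120"
  have q: "poly ?q n = pair_time n + 20 * n + 20" for n
    unfolding poly_add[of _ "120 * ?x"] using b[of n] by (simp add: d pair_time_def)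
  obtain e where e: "\<And>n. poly e n = loop_time n (pair_time n + 20 * n + 20)"
    using loop[of ?q] unfolding q by auto
  obtain g where g: "\<And>n. poly g n = loop_time n (poly e n + 20 * n + 20)"
    using loop[of "e + 20 * ?x + 20"] by (auto simp: mult.commute)
  have "poly (c + g + 100 * ?x + 100) n = cfd_time n" for n
    by (simp add: c g e cfd_time_def)
  then show ?thesis by blast
qed

theorem theorem3:
  shows "\<exists>(c :: com) (p :: nat poly).
    \<forall>(S :: (nat, data, nat) schema) (us :: nat list) (ls :: nat \<Rightarrow> nat list)
      (r :: (nat \<Rightarrow> data) set) (ts :: (nat \<Rightarrow> data) list) (X :: nat set) (A :: nat)
      (f :: oracle_fun).
      schema_context S \<and> relation_over S r \<and> fd_over S X A \<and>
      enumerates us (attrs S) \<and>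
      (\<forall>B\<in>attrs S. enumerates (ls B) (carrier (lat S B))) \<and>
      enumerates ts r \<and>
      cmp_oracle S us ls f \<longrightarrow>
      decides_within c f (enc_input S us ls ts X A)
        (poly p (dsize (enc_input S us ls ts X A)))
        (certain_fd S r X A)"
proof -
  obtain p :: "nat poly" where p: "\<And>n. poly p n = cfd_time n"
    using cfd_time_poly by blast
  show ?thesis
  \<comment> \<open>Program and polynomial are fixed before any schema, enumeration or oracle, which
    is the required uniformity.\<close>
  proof (intro exI[of _ cfd_com] exI[of _ p] allI impI)
    fix S :: "(nat, data, nat) schema" and us ls r ts X A f
    assume "schema_context S \<and> relation_over S r \<and> fd_over S X A \<and>
      enumerates us (attrs S) \<and>
      (\<forall>B\<in>attrs S. enumerates (ls B) (carrier (lat S B))) \<and>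
      enumerates ts r \<and> cmp_oracle S us ls f"
    then interpret cfd_input S us ls r ts X A f by unfold_locales auto
    show "decides_within cfd_com f (enc_input S us ls ts X A)
        (poly p (dsize (enc_input S us ls ts X A))) (certain_fd S r X A)"
      using cfd_com_correct by (simp add: p N_def)
  qed
qed

end
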